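(* Let $(\omega(x))_{x\in\mathbb{Z}^2}$ be IID real random variables with joint law $\mathbb{P}$ (expectation $\mathbb{E}$), with zero mean and unit variance, and such that $e^{\lambda(\beta)}:=\mathbb{E}[e^{\beta\omega(0)}]<\infty$ for all $\beta\in\mathbb{R}$. For $\beta\in\mathbb{R}$ set $$Z_N=Z_N(\beta,\omega):=\sum_{S\in\mathcal S_N}\exp\Big(\beta\sum_{n=0}^N\omega(S_n)\Big).$$ Then for any $\beta\neq 0$, $\mathbb{P}$-almost surely, $$\limsup_{N\to\infty}(Z_N)^{1/N}<\limsup_{N\to\infty}\mathbb{E}[Z_N]^{1/N}=\mu_2\,e^{\lambda(\beta)}.$$
   Context: $\mathcal S_N$ is the set of self-avoiding nearest-neighbor paths $(S_n)_{0\le n\le N}$ of length $N$ on $\mathbb{Z}^2$ with $S_0=0$ (no vertex is visited twice), and $\mu_2:=\lim_{N\to\infty}|\mathcal S_N|^{1/N}$ is the connective constant of $\mathbb{Z}^2$. *)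

theory Defs
  imports "HOL-Probability.Probability"
begin

definition lattice_adj :: "int \<times> int \<Rightarrow> int \<times> int \<Rightarrow> bool" where
  "lattice_adj x y \<longleftrightarrow> \<bar>fst x - fst y\<bar> + \<bar>snd x - snd y\<bar> = 1"

text \<open>A path of length \<open>N\<close> is a function on \<open>{0..N}\<close>. Extensionality fixes its values outside
  this interval, so that distinct elements of the set are distinct paths.\<close>

definition saws :: "nat \<Rightarrow> (nat \<Rightarrow> int \<times> int) set" where
  "saws N = {S \<in> extensional {0..N}.
     S 0 = 0 \<and> (\<forall>n<N. lattice_adj (S n) (S (Suc n))) \<and> inj_on S {0..N}}"

lemma finite_saws: "finite (saws N)"
proof (rule finite_subset)
  let ?B = "{- int N..int N} \<times> {- int N..int N}"
  show "saws N \<subseteq> PiE {0..N} (\<lambda>_. ?B)"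
  proof
    fix S assume S: "S \<in> saws N"
    have "n \<le> N \<Longrightarrow> \<bar>fst (S n)\<bar> + \<bar>snd (S n)\<bar> \<le> int n" for n
    proof (induction n)
      case 0
      then show ?case using S by (simp add: saws_def)
    next
      case (Suc n)
      have "lattice_adj (S n) (S (Suc n))" using S Suc.prems by (simp add: saws_def)
      with Suc show ?case by (simp add: lattice_adj_def)
    qed
    then have "S n \<in> ?B" if "n \<in> {0..N}" for n
      using that by (force simp: mem_Times_iff)
    with S show "S \<in> PiE {0..N} (\<lambda>_. ?B)"
      by (auto simp only: saws_def PiE_iff mem_Collect_eq)
  qed
  show "finite (PiE {0..N} (\<lambda>_. ?B))"
    by (intro finite_PiE) auto
qed

definition connective_constant :: real where
  "connective_constant = lim (\<lambda>N. real (card (saws N)) powr (1 / real N))"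

definition partition_fun :: "real \<Rightarrow> (int \<times> int \<Rightarrow> real) \<Rightarrow> nat \<Rightarrow> real" where
  "partition_fun \<beta> w N = (\<Sum>S\<in>saws N. exp (\<beta> * (\<Sum>n=0..N. w (S n))))"

definition log_mgf :: "'a measure \<Rightarrow> ('a \<Rightarrow> real) \<Rightarrow> real \<Rightarrow> real" where
  "log_mgf M X \<beta> = ln (\<integral>t. exp (\<beta> * X t) \<partial>M)"

end

theory Submission imports Defs begin

text \<open>
  The annealed path measure of a self-avoiding path \<open>S\<close> is the law of the environment with
  the variables on \<open>S\<close> tilted by \<open>exp (\<beta> \<omega>)\<close>, which shifts their mean from \<open>0\<close> to
  some \<open>m \<noteq> 0\<close>. Cut the plane into tiles of side \<open>2 ^ J\<close> and, in each tile, consider the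
  quadratic form \<open>Q = \<Sum> K(x, y) \<omega>(x) \<omega>(y)\<close> over distinct sites, where \<open>K\<close> is a dyadic
  version of the kernel \<open>1 / |x - y|\<close>. Without tilt, \<open>Q\<close> has mean \<open>0\<close> and standard deviation
  of order \<open>2 ^ J * sqrt J\<close>. The sum of \<open>1 / |x - y|\<close> over the pairs of sites of a path segment
  of length \<open>2 ^ J\<close> is at least of order \<open>2 ^ J * J\<close>, so under the tilt the mean of \<open>Q\<close> in a
  tile containing a positive fraction of such a segment is much larger than that. Hence for large
  \<open>J\<close> the event that \<open>Q\<close> exceeds a suitable threshold is very unlikely without tilt and very
  likely with it.

  By a union bound over lattice animals and Borel-Cantelli, almost surely every large connected set
  of \<open>k\<close> tiles containing the origin has at most \<open>k / 18\<close> tiles with large \<open>Q\<close>. A path visiting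
  \<open>k\<close> tiles has at least \<open>k / 9\<close> tiles with a large share of a segment, and under its tilted law
  the probability that half of these have small \<open>Q\<close> is exponentially small in \<open>k\<close>. So \<open>Z_N\<close>
  almost surely agrees, for large \<open>N\<close>, with a truncated sum whose expectation is exponentially
  smaller than that of \<open>Z_N\<close>.
\<close>

section \<open>Existence of the connective constant\<close>

text \<open>Fekete's lemma: the limit is the infimum \<open>L\<close>, since writing
  \<open>n\<close> as a multiple of a near-optimal \<open>m\<close> plus a remainder bounds
  \<open>a n / n\<close> by \<open>a m / m\<close> up to \<open>B / n\<close>. Nonnegativity keeps
  the infimum finite.\<close>

lemma subadditive_convergent:
  fixes a :: "nat \<Rightarrow> real"
  assumes sub: "\<And>m n. a (m + n) \<le> a m + a n" and nn: "\<And>n. 0 \<le> a n"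
  shows "convergent (\<lambda>n. a n / real n)"
proof -
  define L where "L = Inf ((\<lambda>n. a n / real n) ` {1..})"
  have bdd: "bdd_below ((\<lambda>n. a n / real n) ` {1..})"
    by (rule bdd_belowI[of _ 0]) (auto simp: nn)
  have lower: "L \<le> a n / real n" if "n \<ge> 1" for n
    unfolding L_def by (rule cInf_lower[OF _ bdd]) (use that in auto)
  have mult: "a (q * m) \<le> real q * a m + a 0" for q m
  proof (induction q)
    case (Suc q)
    have "a (Suc q * m) \<le> a m + a (q * m)" using sub[of m "q * m"] by simp
    with Suc show ?case by (simp add: algebra_simps)
  qed simp
  have "(\<lambda>n. a n / real n) \<longlonglongrightarrow> L"
  proof (rule LIMSEQ_I)
    fix e :: real assume e: "e > 0"
    obtain m where m: "m \<ge> 1" "a m / real m < L + e / 2"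
      using cInf_lessD[of "(\<lambda>n. a n / real n) ` {1..}" "L + e / 2"] e
      unfolding L_def[symmetric] by auto
    \<comment> \<open>\<open>B\<close> bounds, uniformly in \<open>n\<close>, the remainder term
      \<open>a (n mod m)\<close> together with the \<open>a 0\<close> left over by
      \<open>mult\<close>.\<close>
    define B where "B = a 0 + (\<Sum>r<m. a r)"
    have "B \<ge> 0" unfolding B_def by (intro add_nonneg_nonneg sum_nonneg nn)
    have upper: "a n / real n \<le> a m / real m + B / real n" if n: "n \<ge> 1" for n
    proof -
      have "a n \<le> a (n div m * m) + a (n mod m)"
        using sub[of "n div m * m" "n mod m"] by simp
      also have "a (n mod m) \<le> (\<Sum>r<m. a r)"
        using m by (intro member_le_sum) (auto simp: nn)
      also have "a (n div m * m) \<le> real (n div m) * a m + a 0" by (rule mult)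
      also have "real (n div m) * a m \<le> (real n / real m) * a m"
        by (intro mult_right_mono nn of_nat_div_le_of_nat)
      finally have "a n \<le> (real n / real m) * a m + B" by (simp add: B_def)
      then have "a n / real n \<le> ((real n / real m) * a m + B) / real n"
        by (intro divide_right_mono) auto
      also have "\<dots> = a m / real m + B / real n" using n by (simp add: field_simps)
      finally show ?thesis .
    qed
    obtain n0 :: nat where n0: "2 * B / e < real n0" using reals_Archimedean2 by blast
    show "\<exists>no. \<forall>n\<ge>no. norm (a n / real n - L) < e"
    proof (intro exI allI impI)
      fix n assume n: "n \<ge> max 1 n0"
      have "2 * B / e < real n" using n n0 by simp
      then have "B / real n < e / 2" using n e by (simp add: field_simps)
      moreover have "n \<ge> 1" using n by simp
      ultimately have "L \<le> a n / real n" "a n / real n < L + e"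
        using upper[of n] lower[of n] m(2) by linarith+
      then show "norm (a n / real n - L) < e" by simp
    qed
  qed
  then show ?thesis by (auto simp: convergent_def)
qed

lemma saws_nonempty: "saws N \<noteq> {}"
proof -
  have "restrict (\<lambda>n. (int n, 0)) {0..N} \<in> saws N"
    by (auto simp: saws_def lattice_adj_def inj_on_def zero_prod_def)
  then show ?thesis by blast
qed

lemma card_saws_pos: "1 \<le> card (saws N)"
  using saws_nonempty finite_saws by (simp add: Suc_leI card_gt_0_iff)

text \<open>A path is cut at time \<open>N\<close> and the second piece is translated to the origin.
  Both pieces are self-avoiding and together they determine the path.\<close>

lemma card_saws_add: "card (saws (N + K)) \<le> card (saws N) * card (saws K)"
proof -
  define f where "f S = (restrict S {0..N}, restrict (\<lambda>n. S (N + n) - S N) {0..K})"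
    for S :: "nat \<Rightarrow> int \<times> int"
  have "inj_on f (saws (N + K))"
  proof (rule inj_onI)
    fix S T assume S: "S \<in> saws (N + K)" and T: "T \<in> saws (N + K)" and eq: "f S = f T"
    from eq have e1: "restrict S {0..N} = restrict T {0..N}"
      and e2: "restrict (\<lambda>n. S (N + n) - S N) {0..K} = restrict (\<lambda>n. T (N + n) - T N) {0..K}"
      by (auto simp: f_def)
    have a: "S n = T n" if "n \<le> N" for n
      using fun_cong[OF e1, of n] that by (auto simp: restrict_def)
    have b: "S (N + n) = T (N + n)" if "n \<le> K" for n
      using fun_cong[OF e2, of n] that a[of N] by (auto simp: restrict_def)
    show "S = T"
    proof (rule extensionalityI)
      show "S \<in> extensional {0..N + K}" "T \<in> extensional {0..N + K}"
        using S T by (auto simp: saws_def)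
      fix n assume n: "n \<in> {0..N + K}"
      show "S n = T n"
      proof (cases "n \<le> N")
        case False
        then show ?thesis using b[of "n - N"] n by auto
      qed (rule a)
    qed
  qed
  moreover have "f ` saws (N + K) \<subseteq> saws N \<times> saws K"
  proof
    fix p assume "p \<in> f ` saws (N + K)"
    then obtain S where S: "S \<in> saws (N + K)" and p: "p = f S" by auto
    have adj: "lattice_adj (S n) (S (Suc n))" if "n < N + K" for n
      using S that by (auto simp: saws_def)
    have inj: "inj_on S {0..N + K}" and S0: "S 0 = 0" using S by (auto simp: saws_def)
    have "restrict S {0..N} \<in> saws N"
      using adj S0 inj_on_subset[OF inj, of "{0..N}"] by (auto simp: saws_def)
    moreover have "restrict (\<lambda>n. S (N + n) - S N) {0..K} \<in> saws K"
    proof -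
      have "inj_on (\<lambda>n. S (N + n) - S N) {0..K}"
        by (rule inj_onI) (use inj in \<open>auto dest!: inj_onD\<close>)
      then show ?thesis using adj[of "N + _"] by (auto simp: saws_def lattice_adj_def)
    qed
    ultimately show "p \<in> saws N \<times> saws K" by (auto simp: p f_def)
  qed
  ultimately have "card (saws (N + K)) \<le> card (saws N \<times> saws K)"
    by (rule card_inj_on_le) (simp add: finite_saws)
  then show ?thesis by (simp add: card_cartesian_product)
qed

lemma card_saws_root: "n > 0 \<Longrightarrow>
  real (card (saws n)) powr (1 / real n) = exp (ln (real (card (saws n))) / real n)"
  using card_saws_pos[of n] by (simp add: powr_def)

text \<open>Since \<open>connective_constant\<close> is a \<open>lim\<close>, convergence has to be
  established first. The logarithms of the path counts are subadditive and, there being a path of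
  every length, nonnegative.\<close>

lemma connective_constant_tendsto:
  "(\<lambda>N. real (card (saws N)) powr (1 / real N)) \<longlonglongrightarrow> connective_constant"
proof -
  have "convergent (\<lambda>n. ln (real (card (saws n))) / real n)"
  proof (rule subadditive_convergent)
    fix m n
    have p: "0 < real (card (saws k))" for k using card_saws_pos[of k] by simp
    have "real (card (saws (m + n))) \<le> real (card (saws m)) * real (card (saws n))"
      using card_saws_add[of m n] by (metis of_nat_le_iff of_nat_mult)
    then have "ln (real (card (saws (m + n)))) \<le> ln (real (card (saws m)) * real (card (saws n)))"
      using p by (subst ln_le_cancel_iff) (auto intro!: mult_pos_pos)
    also have "\<dots> = ln (real (card (saws m))) + ln (real (card (saws n)))"
      using p[of m] p[of n] by (simp add: ln_mult)
    finally show "ln (real (card (saws (m + n)))) \<le> \<dots>" .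
  qed (use card_saws_pos in simp)
  then obtain L where "(\<lambda>n. ln (real (card (saws n))) / real n) \<longlonglongrightarrow> L"
    by (auto simp: convergent_def)
  then have "(\<lambda>n. exp (ln (real (card (saws n))) / real n)) \<longlonglongrightarrow> exp L"
    by (rule tendsto_exp)
  then have "(\<lambda>N. real (card (saws N)) powr (1 / real N)) \<longlonglongrightarrow> exp L"
    by (rule Lim_transform_eventually)
       (use card_saws_root in \<open>auto intro!: eventually_sequentiallyI[of 1]\<close>)
  then show ?thesis by (simp add: connective_constant_def limI)
qed

lemma connective_constant_ge_1: "1 \<le> connective_constant"
proof (rule LIMSEQ_le_const[OF connective_constant_tendsto])
  have "1 \<le> real (card (saws n)) powr (1 / real n)" for n
    using card_saws_pos[of n] by (intro ge_one_powr_ge_zero) auto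
  then show "\<exists>N. \<forall>n\<ge>N. 1 \<le> real (card (saws n)) powr (1 / real n)" by blast
qed

section \<open>Second moments of quadratic forms\<close>

text \<open>One coordinate \<open>z (W t)\<close> is added to a form: after expanding the square,
  the cross term vanishes because this coordinate is centered and independent of \<open>Y\<close>.
  This is the induction step of the moment bounds for linear and quadratic forms.\<close>

lemma (in prob_space) second_moment_add_indep:
  fixes Y W :: "'a \<Rightarrow> 'b" and g h z :: "'b \<Rightarrow> real"
  assumes ind: "indep_var N Y K W"
    and [measurable]: "g \<in> borel_measurable N" "h \<in> borel_measurable N" "z \<in> borel_measurable K"
    and g2: "integrable M (\<lambda>t. (g (Y t))\<^sup>2)" and h2: "integrable M (\<lambda>t. (h (Y t))\<^sup>2)"
    and Z2: "integrable M (\<lambda>t. (z (W t))\<^sup>2)" and Z0: "expectation (\<lambda>t. z (W t)) = 0"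
  shows "integrable M (\<lambda>t. (g (Y t) + z (W t) * h (Y t))\<^sup>2)" (is ?int)
    and "expectation (\<lambda>t. (g (Y t) + z (W t) * h (Y t))\<^sup>2)
      = expectation (\<lambda>t. (g (Y t))\<^sup>2)
        + expectation (\<lambda>t. (z (W t))\<^sup>2) * expectation (\<lambda>t. (h (Y t))\<^sup>2)"
      (is ?eq)
proof -
  have [measurable]: "Y \<in> measurable M N" "W \<in> measurable M K"
    using ind by (auto dest: indep_var_rv1 indep_var_rv2)
  have Z1: "integrable M (\<lambda>t. z (W t))"
    by (rule square_integrable_imp_integrable[OF _ Z2]) simp
  have gh: "integrable M (\<lambda>t. g (Y t) * h (Y t))"
  proof (rule Bochner_Integration.integrable_bound)
    show "integrable M (\<lambda>t. (g (Y t))\<^sup>2 + (h (Y t))\<^sup>2)" using g2 h2 by simp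
    have "\<bar>a * b\<bar> \<le> a\<^sup>2 + b\<^sup>2" for a b :: real
    proof -
      have "2 * \<bar>a * b\<bar> \<le> a\<^sup>2 + b\<^sup>2"
        using sum_squares_bound[of "\<bar>a\<bar>" "\<bar>b\<bar>"] by (simp add: abs_mult mult.assoc)
      then show ?thesis by linarith
    qed
    then show "AE t in M. norm (g (Y t) * h (Y t)) \<le> norm ((g (Y t))\<^sup>2 + (h (Y t))\<^sup>2)"
      by simp
  qed simp
  have i1: "indep_var borel (\<lambda>t. g (Y t) * h (Y t)) borel (\<lambda>t. z (W t))"
    using indep_var_compose[OF ind, of "\<lambda>y. g y * h y" borel z borel]
    by (simp add: comp_def)
  have i2: "indep_var borel (\<lambda>t. (h (Y t))\<^sup>2) borel (\<lambda>t. (z (W t))\<^sup>2)"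
    using indep_var_compose[OF ind, of "\<lambda>y. (h y)\<^sup>2" borel "\<lambda>w. (z w)\<^sup>2" borel]
    by (simp add: comp_def)
  have c1: "integrable M (\<lambda>t. g (Y t) * h (Y t) * z (W t))"
      "expectation (\<lambda>t. g (Y t) * h (Y t) * z (W t)) = 0"
    using indep_var_integrable[OF i1 gh Z1] indep_var_lebesgue_integral[OF i1 gh Z1] Z0 by auto
  have c2: "integrable M (\<lambda>t. (h (Y t))\<^sup>2 * (z (W t))\<^sup>2)"
      "expectation (\<lambda>t. (h (Y t))\<^sup>2 * (z (W t))\<^sup>2)
        = expectation (\<lambda>t. (h (Y t))\<^sup>2) * expectation (\<lambda>t. (z (W t))\<^sup>2)"
    using indep_var_integrable[OF i2 h2 Z2] indep_var_lebesgue_integral[OF i2 h2 Z2] by auto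
  have exp: "(g (Y t) + z (W t) * h (Y t))\<^sup>2
      = (g (Y t))\<^sup>2 + 2 * (g (Y t) * h (Y t) * z (W t)) + (h (Y t))\<^sup>2 * (z (W t))\<^sup>2" for t
    by (simp add: power2_eq_square algebra_simps)
  show ?int unfolding exp using g2 c1 c2 by simp
  show ?eq unfolding exp using g2 c1 c2 by simp
qed

lemma (in prob_space) indep_var_restrict_insert:
  assumes "indep_vars (\<lambda>_. borel) X (insert a A)" "a \<notin> A"
  shows "indep_var (PiM A (\<lambda>_. borel)) (\<lambda>t. restrict (\<lambda>i. X i t) A)
    (PiM {a} (\<lambda>_. borel)) (\<lambda>t. restrict (\<lambda>i. X i t) {a})"
  by (rule indep_var_restrict[OF assms(1)]) (use assms in auto)

text \<open>Second moments are bounded by \<open>s\<close> rather than equal to it, because tilted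
  variables are not identically distributed. The constant \<open>c0\<close> is there because such a
  form is the coefficient of a new site in a quadratic form with linear part.\<close>

lemma (in prob_space) linear_form_second_moment:
  fixes X :: "'i \<Rightarrow> 'a \<Rightarrow> real" and c :: "'i \<Rightarrow> real"
  assumes "finite A" and "indep_vars (\<lambda>_. borel) X A"
    and "\<And>x. x \<in> A \<Longrightarrow> integrable M (\<lambda>t. (X x t)\<^sup>2)"
    and "\<And>x. x \<in> A \<Longrightarrow> expectation (X x) = 0"
    and "\<And>x. x \<in> A \<Longrightarrow> expectation (\<lambda>t. (X x t)\<^sup>2) \<le> s"
  shows "integrable M (\<lambda>t. (c0 + (\<Sum>x\<in>A. c x * X x t))\<^sup>2) \<and>
    expectation (\<lambda>t. (c0 + (\<Sum>x\<in>A. c x * X x t))\<^sup>2) \<le> c0\<^sup>2 + s * (\<Sum>x\<in>A. (c x)\<^sup>2)"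
  using assms
proof (induction A rule: finite_induct)
  case empty
  then show ?case by (simp add: prob_space)
next
  case (insert a A)
  define Y where "Y t = restrict (\<lambda>i. X i t) A" for t
  define g where "g f = c0 + (\<Sum>x\<in>A. c x * f x)" for f :: "'i \<Rightarrow> real"
  have IH: "integrable M (\<lambda>t. (c0 + (\<Sum>x\<in>A. c x * X x t))\<^sup>2)"
    "expectation (\<lambda>t. (c0 + (\<Sum>x\<in>A. c x * X x t))\<^sup>2) \<le> c0\<^sup>2 + s * (\<Sum>x\<in>A. (c x)\<^sup>2)"
    using insert.IH indep_vars_subset[OF insert.prems(1)] insert.prems by auto
  have gY: "g (Y t) = c0 + (\<Sum>x\<in>A. c x * X x t)" for t
    by (simp add: g_def Y_def)
  have ind: "indep_var (PiM A (\<lambda>_. borel)) Y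
      (PiM {a} (\<lambda>_. borel)) (\<lambda>t. restrict (\<lambda>i. X i t) {a})"
    unfolding Y_def by (rule indep_var_restrict_insert) (use insert in auto)
  have [measurable]: "g \<in> borel_measurable (PiM A (\<lambda>_. borel))"
    unfolding g_def by measurable
  have "integrable M (\<lambda>t. (g (Y t))\<^sup>2)" using IH by (simp add: gY)
  note * = second_moment_add_indep[OF ind, of g "\<lambda>_. c a" "\<lambda>f. f a", OF _ _ _ this, simplified]
  have sum: "c0 + (\<Sum>x\<in>insert a A. c x * X x t) = g (Y t) + X a t * c a" for t
    using insert.hyps by (simp add: gY)
  have 1: "integrable M (\<lambda>t. (g (Y t) + X a t * c a)\<^sup>2)"
    using insert.prems by (intro *) auto
  have 2: "expectation (\<lambda>t. (g (Y t) + X a t * c a)\<^sup>2)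
      = expectation (\<lambda>t. (g (Y t))\<^sup>2) + expectation (\<lambda>t. (X a t)\<^sup>2) * (c a)\<^sup>2"
    using insert.prems by (subst *) (auto simp: prob_space)
  also have "\<dots> \<le> (c0\<^sup>2 + s * (\<Sum>x\<in>A. (c x)\<^sup>2)) + s * (c a)\<^sup>2"
    using IH insert.prems by (intro add_mono mult_right_mono) (auto simp: gY)
  finally show ?case
    unfolding sum using 1 insert.hyps by (simp add: algebra_simps)
qed

text \<open>Without the diagonal the form has mean zero for centered independent variables, and its
  variance involves no fourth moments. Every unordered pair is counted twice.\<close>

definition quadratic_form :: "('i \<Rightarrow> 'i \<Rightarrow> real) \<Rightarrow> 'i set \<Rightarrow> ('i \<Rightarrow> real) \<Rightarrow> real" where
  "quadratic_form V A f = (\<Sum>x\<in>A. \<Sum>y\<in>A - {x}. V x y * f x * f y)"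

lemma quadratic_form_insert:
  assumes "finite A" "a \<notin> A" and sym: "\<And>x y. V x y = V y x"
  shows "quadratic_form V (insert a A) f = quadratic_form V A f + f a * (2 * (\<Sum>y\<in>A. V a y * f y))"
proof -
  have "(\<Sum>y\<in>insert a A - {x}. V x y * f x * f y)
      = V x a * f x * f a + (\<Sum>y\<in>A - {x}. V x y * f x * f y)" if "x \<in> A" for x
  proof -
    have "insert a A - {x} = insert a (A - {x})" using that assms by auto
    then show ?thesis using assms by simp
  qed
  moreover have "insert a A - {a} = A" using assms by auto
  moreover have "(\<Sum>x\<in>A. V x a * f x * f a) = f a * (\<Sum>y\<in>A. V a y * f y)"
    using sym[of _ a] by (simp add: sum_distrib_left mult_ac)
  moreover have "(\<Sum>x\<in>A. V a x * f a * f x) = f a * (\<Sum>y\<in>A. V a y * f y)"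
    by (simp add: sum_distrib_left mult_ac)
  ultimately show ?thesis
    using assms by (simp add: quadratic_form_def sum.distrib)
qed

text \<open>A new site \<open>a\<close> adds \<open>X a\<close> times an independent linear form
  with constant \<open>c a\<close> and coefficients \<open>2 * V a y\<close>, so the second moments
  add up. The factor 4 from squaring becomes the 2 of the bound because each pair occurs in two
  orders.\<close>

lemma (in prob_space) quadratic_form_second_moment:
  fixes X :: "'i \<Rightarrow> 'a \<Rightarrow> real" and c :: "'i \<Rightarrow> real"
  assumes "finite A" and "indep_vars (\<lambda>_. borel) X A"
    and "\<And>x. x \<in> A \<Longrightarrow> integrable M (\<lambda>t. (X x t)\<^sup>2)"
    and "\<And>x. x \<in> A \<Longrightarrow> expectation (X x) = 0"
    and "\<And>x. x \<in> A \<Longrightarrow> expectation (\<lambda>t. (X x t)\<^sup>2) \<le> s"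
    and sym: "\<And>x y. V x y = V y x"
  shows "integrable M (\<lambda>t. ((\<Sum>x\<in>A. c x * X x t) + quadratic_form V A (\<lambda>x. X x t))\<^sup>2) \<and>
    expectation (\<lambda>t. ((\<Sum>x\<in>A. c x * X x t) + quadratic_form V A (\<lambda>x. X x t))\<^sup>2)
      \<le> s * (\<Sum>x\<in>A. (c x)\<^sup>2) + 2 * s\<^sup>2 * (\<Sum>x\<in>A. \<Sum>y\<in>A - {x}. (V x y)\<^sup>2)"
  using assms(1-5)
proof (induction A rule: finite_induct)
  case empty
  then show ?case by (simp add: quadratic_form_def)
next
  case (insert a A)
  define Y where "Y t = restrict (\<lambda>i. X i t) A" for t
  define g where "g f = (\<Sum>x\<in>A. c x * f x) + quadratic_form V A f" for f :: "'i \<Rightarrow> real"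
  define h where "h f = c a + (\<Sum>y\<in>A. (2 * V a y) * f y)" for f :: "'i \<Rightarrow> real"
  have sub: "indep_vars (\<lambda>_. borel) X A"
    by (rule indep_vars_subset[OF insert.prems(1)]) auto
  have gY: "g (Y t) = (\<Sum>x\<in>A. c x * X x t) + quadratic_form V A (\<lambda>x. X x t)" for t
    by (auto simp: g_def Y_def quadratic_form_def intro!: sum.cong)
  have hY: "h (Y t) = c a + (\<Sum>y\<in>A. (2 * V a y) * X y t)" for t
    by (simp add: h_def Y_def)
  have IH: "integrable M (\<lambda>t. (g (Y t))\<^sup>2)"
    "expectation (\<lambda>t. (g (Y t))\<^sup>2)
      \<le> s * (\<Sum>x\<in>A. (c x)\<^sup>2) + 2 * s\<^sup>2 * (\<Sum>x\<in>A. \<Sum>y\<in>A - {x}. (V x y)\<^sup>2)"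
    unfolding gY using insert.IH sub insert.prems by auto
  have H: "integrable M (\<lambda>t. (h (Y t))\<^sup>2)"
    "expectation (\<lambda>t. (h (Y t))\<^sup>2) \<le> (c a)\<^sup>2 + s * (\<Sum>y\<in>A. (2 * V a y)\<^sup>2)"
    unfolding hY using linear_form_second_moment[OF insert.hyps(1) sub, of s "c a" "\<lambda>y. 2 * V a y"]
      insert.prems by auto
  have ind: "indep_var (PiM A (\<lambda>_. borel)) Y
      (PiM {a} (\<lambda>_. borel)) (\<lambda>t. restrict (\<lambda>i. X i t) {a})"
    unfolding Y_def by (rule indep_var_restrict_insert) (use insert in auto)
  have [measurable]: "g \<in> borel_measurable (PiM A (\<lambda>_. borel))"
    unfolding g_def quadratic_form_def by measurable
  have [measurable]: "h \<in> borel_measurable (PiM A (\<lambda>_. borel))"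
    unfolding h_def by measurable
  note * = second_moment_add_indep[OF ind, of g h "\<lambda>f. f a", OF _ _ _ IH(1) H(1), simplified]
  have sum: "(\<Sum>x\<in>insert a A. c x * X x t) + quadratic_form V (insert a A) (\<lambda>x. X x t)
      = g (Y t) + X a t * h (Y t)" for t
    using insert.hyps
    by (simp add: gY hY quadratic_form_insert[OF _ _ sym] algebra_simps sum_distrib_left)
  have 1: "integrable M (\<lambda>t. (g (Y t) + X a t * h (Y t))\<^sup>2)"
    using insert.prems by (intro *) auto
  have "0 \<le> expectation (\<lambda>t. (X a t)\<^sup>2)" by simp
  also have "\<dots> \<le> s" using insert.prems(4)[of a] by simp
  finally have s0: "0 \<le> s" .
  have "expectation (\<lambda>t. (g (Y t) + X a t * h (Y t))\<^sup>2)
      = expectation (\<lambda>t. (g (Y t))\<^sup>2)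
        + expectation (\<lambda>t. (X a t)\<^sup>2) * expectation (\<lambda>t. (h (Y t))\<^sup>2)"
    using insert.prems by (subst *) auto
  also have "\<dots> \<le> (s * (\<Sum>x\<in>A. (c x)\<^sup>2) + 2 * s\<^sup>2 * (\<Sum>x\<in>A. \<Sum>y\<in>A - {x}. (V x y)\<^sup>2))
      + s * ((c a)\<^sup>2 + s * (\<Sum>y\<in>A. (2 * V a y)\<^sup>2))"
    using IH H insert.prems s0 by (intro add_mono mult_mono) auto
  also have "\<dots> = s * (\<Sum>x\<in>insert a A. (c x)\<^sup>2)
      + 2 * s\<^sup>2 * quadratic_form (\<lambda>x y. (V x y)\<^sup>2) (insert a A) (\<lambda>_. 1)"
    using insert.hyps quadratic_form_insert[of A a "\<lambda>x y. (V x y)\<^sup>2" "\<lambda>_. 1"] sym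
    by (simp add: quadratic_form_def[of _ A] algebra_simps power2_eq_square sum_distrib_left)
  finally show ?case
    unfolding sum using 1 by (simp add: quadratic_form_def)
qed

section \<open>Tilting finitely many coordinates of an independent family\<close>

text \<open>Weights are \<open>ennreal\<close>-valued so that the change of measure is computed with
  nonnegative integrals, free of integrability conditions. By \<open>w_int\<close> the product
  density has total mass 1.\<close>

locale tilted_field = prob_space M for M :: "'a measure" +
  fixes X :: "'i \<Rightarrow> 'a \<Rightarrow> real" and F :: "'i set" and w :: "real \<Rightarrow> ennreal"
  assumes indep: "indep_vars (\<lambda>_. borel) X UNIV"
    and finF: "finite F" and w_meas[measurable]: "w \<in> borel_measurable borel"
    and w_int: "\<And>x. x \<in> F \<Longrightarrow> (\<integral>\<^sup>+t. w (X x t) \<partial>M) = 1"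
begin

definition "tilt = density M (\<lambda>t. \<Prod>x\<in>F. w (X x t))"

lemma X_meas[measurable]: "X x \<in> borel_measurable M"
  using indep by (auto simp: indep_vars_def)

lemma sets_tilt[measurable_cong]: "sets tilt = sets M" and space_tilt: "space tilt = space M"
  by (auto simp: tilt_def)

text \<open>All properties of \<open>tilt\<close> come from this factorization: independence splits
  the integral over \<open>F \<union> J\<close>, and each site of \<open>F\<close> outside
  \<open>J\<close> contributes its normalization 1.\<close>

lemma nn_integral_tilt_prod:
  assumes J: "finite J" and [measurable]: "\<And>x. g x \<in> borel_measurable borel"
  shows "(\<integral>\<^sup>+t. (\<Prod>x\<in>J. g x (X x t)) \<partial>tilt)
    = (\<Prod>x\<in>J. \<integral>\<^sup>+t. (if x \<in> F then w (X x t) else 1) * g x (X x t) \<partial>M)"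
proof -
  define h where "h x y = (if x \<in> F then w y else 1) * (if x \<in> J then g x y else 1)" for x y
  have [measurable]: "h x \<in> borel_measurable borel" for x
    unfolding h_def by measurable
  have "(\<integral>\<^sup>+t. (\<Prod>x\<in>J. g x (X x t)) \<partial>tilt)
      = (\<integral>\<^sup>+t. (\<Prod>x\<in>F. w (X x t)) * (\<Prod>x\<in>J. g x (X x t)) \<partial>M)"
    unfolding tilt_def by (subst nn_integral_density) auto
  also have "\<dots> = (\<integral>\<^sup>+t. (\<Prod>x\<in>F \<union> J. h x (X x t)) \<partial>M)"
  proof (intro nn_integral_cong)
    fix t
    have "(\<Prod>x\<in>F. w (X x t)) = (\<Prod>x\<in>F \<union> J. if x \<in> F then w (X x t) else 1)"
      using finF J by (intro prod.mono_neutral_cong_left) auto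
    moreover have "(\<Prod>x\<in>J. g x (X x t)) = (\<Prod>x\<in>F \<union> J. if x \<in> J then g x (X x t) else 1)"
      using finF J by (intro prod.mono_neutral_cong_left) auto
    ultimately show "(\<Prod>x\<in>F. w (X x t)) * (\<Prod>x\<in>J. g x (X x t)) = (\<Prod>x\<in>F \<union> J. h x (X x t))"
      by (simp add: h_def prod.distrib)
  qed
  also have "\<dots> = (\<Prod>x\<in>F \<union> J. \<integral>\<^sup>+t. h x (X x t) \<partial>M)"
  proof (rule indep_vars_nn_integral)
    show "indep_vars (\<lambda>_. borel) (\<lambda>x t. h x (X x t)) (F \<union> J)"
      by (rule indep_vars_compose2[OF indep_vars_subset[OF indep]]) auto
  qed (use finF J in auto)
  also have "\<dots> = (\<Prod>x\<in>J. \<integral>\<^sup>+t. h x (X x t) \<partial>M)"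
    using finF J w_int by (intro prod.mono_neutral_right) (auto simp: h_def)
  also have "\<dots> = (\<Prod>x\<in>J. \<integral>\<^sup>+t. (if x \<in> F then w (X x t) else 1) * g x (X x t) \<partial>M)"
    by (intro prod.cong nn_integral_cong) (auto simp: h_def)
  finally show ?thesis .
qed

lemma nn_integral_tilt:
  assumes [measurable]: "g \<in> borel_measurable borel"
  shows "(\<integral>\<^sup>+t. g (X x t) \<partial>tilt) = (\<integral>\<^sup>+t. (if x \<in> F then w (X x t) else 1) * g (X x t) \<partial>M)"
  using nn_integral_tilt_prod[of "{x}" "\<lambda>_. g"] by simp

lemma prob_space_tilt: "prob_space tilt"
proof
  show "emeasure tilt (space tilt) = 1"
    using nn_integral_tilt_prod[of "{}" "\<lambda>_ _. 1"] by simp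
qed

sublocale tilt: prob_space tilt
  by (rule prob_space_tilt)

lemma emeasure_distr_tilt:
  assumes [measurable]: "A \<in> sets borel"
  shows "emeasure (distr tilt borel (X x)) A
    = (\<integral>\<^sup>+t. (if x \<in> F then w (X x t) else 1) * indicator A (X x t) \<partial>M)"
proof -
  have "emeasure (distr tilt borel (X x)) A = (\<integral>\<^sup>+y. indicator A y \<partial>distr tilt borel (X x))"
    by (rule nn_integral_indicator[symmetric]) simp
  also have "\<dots> = (\<integral>\<^sup>+t. indicator A (X x t) \<partial>tilt)"
    by (rule nn_integral_distr) auto
  finally show ?thesis by (simp only: nn_integral_tilt borel_measurable_indicator assms)
qed

lemma distr_tilt_notin:
  assumes "x \<notin> F"
  shows "distr tilt borel (X x) = distr M borel (X x)"
proof (rule measure_eqI)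
  fix A assume "A \<in> sets (distr tilt borel (X x))"
  then have [measurable]: "A \<in> sets borel" by simp
  have "emeasure (distr M borel (X x)) A = (\<integral>\<^sup>+y. indicator A y \<partial>distr M borel (X x))"
    by (rule nn_integral_indicator[symmetric]) simp
  also have "\<dots> = (\<integral>\<^sup>+t. indicator A (X x t) \<partial>M)"
    by (rule nn_integral_distr) auto
  finally show "emeasure (distr tilt borel (X x)) A = emeasure (distr M borel (X x)) A"
    using assms by (simp only: emeasure_distr_tilt \<open>A \<in> sets borel\<close> if_False mult_1)
qed simp

lemma distr_tilt_in:
  assumes "x \<in> F"
  shows "distr tilt borel (X x) = density (distr M borel (X x)) w"
proof (rule measure_eqI)
  fix A assume "A \<in> sets (distr tilt borel (X x))"
  then have [measurable]: "A \<in> sets borel" by simp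
  have "emeasure (density (distr M borel (X x)) w) A
      = (\<integral>\<^sup>+y. w y * indicator A y \<partial>distr M borel (X x))"
    by (rule emeasure_density) auto
  also have "\<dots> = (\<integral>\<^sup>+t. w (X x t) * indicator A (X x t) \<partial>M)"
    by (rule nn_integral_distr) auto
  finally show "emeasure (distr tilt borel (X x)) A = emeasure (density (distr M borel (X x)) w) A"
    using assms by (simp only: emeasure_distr_tilt \<open>A \<in> sets borel\<close> if_True)
qed simp

lemma indep_tilt: "tilt.indep_vars (\<lambda>_. borel) X UNIV"
  unfolding tilt.indep_vars_def2
proof (intro conjI ballI tilt.indep_setsI)
  show "tilt.random_variable borel (X i)" for i by measurable
  show "{X i -` A \<inter> space tilt |A. A \<in> sets borel} \<subseteq> tilt.events" for i
    by (auto simp: sets_tilt space_tilt)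
  fix A :: "'i \<Rightarrow> 'a set" and J :: "'i set"
  assume J: "J \<noteq> {}" "finite J" and A: "\<forall>j\<in>J. A j \<in> {X j -` A \<inter> space tilt |A. A \<in> sets borel}"
  have "\<forall>j\<in>J. \<exists>B. B \<in> sets borel \<and> A j = X j -` B \<inter> space M"
    using A by (auto simp: space_tilt)
  then obtain B where B: "\<And>j. j \<in> J \<Longrightarrow> B j \<in> sets borel \<and> A j = X j -` B j \<inter> space M"
    by (auto dest!: bchoice)
  \<comment> \<open>The value outside \<open>J\<close> is a default: the factorization asks for
    measurable functions at every index.\<close>
  define C where "C j = (if j \<in> J then B j else {})" for j
  have [measurable]: "C j \<in> sets borel" for j using B by (auto simp: C_def)
  have AC: "A j = {t \<in> space tilt. X j t \<in> C j}" if "j \<in> J" for j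
    using B[OF that] that by (auto simp: C_def space_tilt)
  have "emeasure tilt (\<Inter>j\<in>J. A j) = (\<integral>\<^sup>+t. indicator (\<Inter>j\<in>J. A j) t \<partial>tilt)"
    using J AC by (intro nn_integral_indicator[symmetric] sets.finite_INT) auto
  also have "\<dots> = (\<integral>\<^sup>+t. (\<Prod>j\<in>J. indicator (C j) (X j t)) \<partial>tilt)"
  proof (intro nn_integral_cong)
    fix t assume t: "t \<in> space tilt"
    show "indicator (\<Inter>j\<in>J. A j) t = (\<Prod>j\<in>J. indicator (C j) (X j t) :: ennreal)"
    proof (cases "\<forall>j\<in>J. X j t \<in> C j")
      case True
      then have "t \<in> (\<Inter>j\<in>J. A j)" using t AC by auto
      then show ?thesis using True by simp
    next
      case False
      then obtain j where j: "j \<in> J" "X j t \<notin> C j" by auto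
      then have "(\<Prod>j\<in>J. indicator (C j) (X j t) :: ennreal) = 0"
        using J by (intro prod_zero) (auto intro!: bexI[of _ j])
      moreover have "t \<notin> (\<Inter>j\<in>J. A j)" using j AC[of j] by auto
      ultimately show ?thesis by simp
    qed
  qed
  also have "\<dots> = (\<Prod>j\<in>J. \<integral>\<^sup>+t. indicator (C j) (X j t) \<partial>tilt)"
    by (subst nn_integral_tilt_prod) (simp_all add: J nn_integral_tilt)
  also have "\<dots> = (\<Prod>j\<in>J. emeasure tilt (A j))"
  proof (intro prod.cong refl)
    fix j assume j: "j \<in> J"
    have "(\<integral>\<^sup>+t. indicator (C j) (X j t) \<partial>tilt) = (\<integral>\<^sup>+t. indicator (A j) t \<partial>tilt)"
      using AC[OF j] by (intro nn_integral_cong) (auto simp: indicator_def)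
    also have "\<dots> = emeasure tilt (A j)"
      using AC[OF j] by (intro nn_integral_indicator) auto
    finally show "(\<integral>\<^sup>+t. indicator (C j) (X j t) \<partial>tilt) = emeasure tilt (A j)" .
  qed
  finally show "tilt.prob (\<Inter>j\<in>J. A j) = (\<Prod>j\<in>J. tilt.prob (A j))"
    by (simp add: tilt.emeasure_eq_measure prod_ennreal prod_nonneg)
qed

end

section \<open>The dyadic kernel\<close>

definition cell :: "nat \<Rightarrow> int \<times> int \<Rightarrow> int \<times> int" where
  "cell j x = (fst x div 2 ^ j, snd x div 2 ^ j)"

definition tile :: "nat \<Rightarrow> int \<times> int \<Rightarrow> (int \<times> int) set" where
  "tile j a = {x. cell j x = a}"

definition same_cells :: "nat \<Rightarrow> (int \<times> int) set \<Rightarrow> real" where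
  "same_cells j U = (\<Sum>x\<in>U. \<Sum>y\<in>U. of_bool (cell j x = cell j y))"

text \<open>A geometric series that starts at the first level where \<open>x\<close> and
  \<open>y\<close> lie in one dyadic square, hence for distinct sites at most twice the inverse of
  their distance in the maximum norm. Keeping the sum over levels reduces the estimates to counting
  within squares of one size.\<close>

definition dyadic_kernel :: "nat \<Rightarrow> int \<times> int \<Rightarrow> int \<times> int \<Rightarrow> real" where
  "dyadic_kernel J x y = (\<Sum>j\<le>J. (1/2) ^ j * of_bool (cell j x = cell j y))"

definition energy :: "nat \<Rightarrow> (int \<times> int) set \<Rightarrow> real" where
  "energy J U = (\<Sum>x\<in>U. \<Sum>y\<in>U. dyadic_kernel J x y)"

text \<open>Sums of indicators are kept as sums, since the estimates exchange orders of
  summation.\<close>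

declare sum_of_bool_eq [simp del] sum_mult_of_bool_eq [simp del] sum_of_bool_mult_eq [simp del]

lemma tile_eq:
  "tile j a = {fst a * 2 ^ j..<(fst a + 1) * 2 ^ j} \<times> {snd a * 2 ^ j..<(snd a + 1) * 2 ^ j}"
proof -
  have "x div 2 ^ j = b \<longleftrightarrow> b * 2 ^ j \<le> x \<and> x < (b + 1) * 2 ^ j" for x b :: int
  proof
    assume b: "x div 2 ^ j = b"
    have "x = b * 2 ^ j + x mod 2 ^ j" using div_mult_mod_eq[of x "2 ^ j"] b by simp
    moreover have "0 \<le> x mod 2 ^ j" "x mod 2 ^ j < 2 ^ j" by simp_all
    moreover have "(b + 1) * 2 ^ j = b * 2 ^ j + 2 ^ j" by (simp add: ring_distribs)
    ultimately show "b * 2 ^ j \<le> x \<and> x < (b + 1) * 2 ^ j" by linarith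
  next
    assume *: "b * 2 ^ j \<le> x \<and> x < (b + 1) * 2 ^ j"
    have "(b + 1) * 2 ^ j = b * 2 ^ j + 2 ^ j" by (simp add: ring_distribs)
    with * have "0 \<le> x - b * 2 ^ j" "x - b * 2 ^ j < 2 ^ j" by linarith+
    then show "x div 2 ^ j = b"
      by (intro int_div_pos_eq[of x "2 ^ j" b "x - b * 2 ^ j"]) (auto simp: mult.commute)
  qed
  then show ?thesis by (auto simp: tile_def cell_def prod_eq_iff)
qed

lemma finite_tile [simp]: "finite (tile j a)"
  by (simp add: tile_eq)

lemma card_tile: "card (tile j a) = 4 ^ j"
proof -
  have "nat ((b + 1) * 2 ^ j - b * 2 ^ j) = 2 ^ j" for b :: int
    by (simp add: algebra_simps nat_power_eq)
  then have "card (tile j a) = 2 ^ j * 2 ^ j"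
    by (simp only: tile_eq card_cartesian_product card_atLeastLessThan_int)
  then show ?thesis by (simp add: power_mult_distrib[symmetric])
qed

lemma disjoint_tiles: "disjoint_family (tile j)"
  by (auto simp: disjoint_family_on_def tile_def)

lemma cell_add: "cell (i + j) x = cell j (cell i x)"
  by (simp add: cell_def power_add zdiv_zmult2_eq)

lemma cell_mono: "cell i x = cell i y \<Longrightarrow> i \<le> j \<Longrightarrow> cell j x = cell j y"
  using cell_add[of i "j - i"] by simp

lemma tile_cell: "i \<le> j \<Longrightarrow> x \<in> tile j a \<Longrightarrow> {y \<in> tile j a. cell i x = cell i y} = tile i (cell i x)"
  unfolding tile_def by (auto dest: cell_mono[where j = j])

lemma sum_same_cell:
  assumes "i \<le> j" "x \<in> tile j a"
  shows "(\<Sum>y\<in>tile j a. of_bool (cell i x = cell i y)) = (4 ^ i :: real)"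
proof -
  have "(\<Sum>y\<in>tile j a. of_bool (cell i x = cell i y) :: real)
      = real (card {y \<in> tile j a. cell i x = cell i y})"
    by (simp add: of_bool_def sum.If_cases Int_def)
  then show ?thesis by (simp add: tile_cell[OF assms] card_tile)
qed

lemma dyadic_kernel_sym: "dyadic_kernel J x y = dyadic_kernel J y x"
  unfolding dyadic_kernel_def by (intro sum.cong refl) (auto simp: of_bool_def)

lemma dyadic_kernel_nonneg: "0 \<le> dyadic_kernel J x y"
  unfolding dyadic_kernel_def by (intro sum_nonneg) auto

lemma dyadic_kernel_le_2: "dyadic_kernel J x y \<le> 2"
proof -
  have "dyadic_kernel J x y \<le> (\<Sum>j\<le>J. (1/2) ^ j)"
    unfolding dyadic_kernel_def by (intro sum_mono) auto
  also have "\<dots> \<le> 2" by (simp add: sum_gp0)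
  finally show ?thesis .
qed

lemma energy_altdef: "energy J U = (\<Sum>j\<le>J. (1/2) ^ j * same_cells j U)"
proof -
  have "energy J U = (\<Sum>x\<in>U. \<Sum>j\<le>J. \<Sum>y\<in>U. (1/2) ^ j * of_bool (cell j x = cell j y))"
    unfolding energy_def dyadic_kernel_def by (intro sum.cong refl sum.swap)
  also have "\<dots> = (\<Sum>j\<le>J. \<Sum>x\<in>U. \<Sum>y\<in>U. (1/2) ^ j * of_bool (cell j x = cell j y))"
    by (rule sum.swap)
  also have "\<dots> = (\<Sum>j\<le>J. (1/2) ^ j * same_cells j U)"
    by (simp only: same_cells_def sum_distrib_left)
  finally show ?thesis .
qed

text \<open>Sharing a cell persists at coarser levels, so the kernel is a geometric tail, comparable
  to its first term. Its square therefore exceeds the sum of the squared terms by a constant factor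
  at most.\<close>

lemma dyadic_kernel_square_le: "(dyadic_kernel J x y)\<^sup>2 \<le> 4 * (\<Sum>j\<le>J. (1/4) ^ j * of_bool (cell j x = cell j y))"
proof -
  \<comment> \<open>The upward closed predicate \<open>P\<close> lets the induction shift levels by
    one: if level 0 is present, the whole sum is at most 2; otherwise both sides shrink by the
    factor 1/4.\<close>
  have *: "(\<Sum>j\<le>J. (1/2) ^ j * of_bool (P j))\<^sup>2 \<le> 4 * (\<Sum>j\<le>J. (1/4) ^ j * of_bool (P j) :: real)"
    if "\<And>i j. P i \<Longrightarrow> i \<le> j \<Longrightarrow> P j" for P :: "nat \<Rightarrow> bool"
    using that
  proof (induction J arbitrary: P)
    case 0
    then show ?case by simp
  next
    case (Suc J)
    let ?s = "\<Sum>j\<le>J. (1/2) ^ j * of_bool (P (Suc j)) :: real"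
    let ?t = "\<Sum>j\<le>J. (1/4) ^ j * of_bool (P (Suc j)) :: real"
    have IH: "?s\<^sup>2 \<le> 4 * ?t" by (rule Suc.IH) (rule Suc.prems, assumption, simp)
    have e: "(\<Sum>j\<le>Suc J. (1/2) ^ j * of_bool (P j)) = of_bool (P 0) + ?s / 2"
      "(\<Sum>j\<le>Suc J. (1/4) ^ j * of_bool (P j)) = of_bool (P 0) + ?t / 4"
      by (subst sum.atMost_Suc_shift, simp add: sum_divide_distrib)+
    show ?case
    proof (cases "P 0")
      case True
      have s: "0 \<le> ?s" "?s \<le> (\<Sum>j\<le>J. (1/2) ^ j)"
        by (auto intro!: sum_nonneg sum_mono)
      have "(\<Sum>j\<le>J. (1/2::real) ^ j) \<le> 2" by (simp add: sum_gp0)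
      with s have "(1 + ?s / 2)\<^sup>2 \<le> 2\<^sup>2" by (intro power_mono) auto
      moreover have "0 \<le> ?t" by (intro sum_nonneg) auto
      ultimately show ?thesis unfolding e using True by simp
    next
      case False
      then show ?thesis unfolding e using IH by (simp add: power_divide)
    qed
  qed
  show ?thesis unfolding dyadic_kernel_def
    by (rule *) (rule cell_mono)
qed

text \<open>The kernel barely fails to be square summable in the plane: at level \<open>j\<close>
  there are \<open>4 ^ j\<close> sites of squared weight \<open>(1/4) ^ j\<close>, so each of the
  \<open>J + 1\<close> levels contributes 1.\<close>

lemma sum_dyadic_kernel_square_le:
  assumes "x \<in> tile J a"
  shows "(\<Sum>y\<in>tile J a. (dyadic_kernel J x y)\<^sup>2) \<le> 4 * (real J + 1)"
proof -
  have "(\<Sum>y\<in>tile J a. (dyadic_kernel J x y)\<^sup>2)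
      \<le> (\<Sum>y\<in>tile J a. 4 * (\<Sum>j\<le>J. (1/4) ^ j * of_bool (cell j x = cell j y)))"
    by (intro sum_mono dyadic_kernel_square_le)
  also have "\<dots> = 4 * (\<Sum>j\<le>J. \<Sum>y\<in>tile J a. (1/4) ^ j * of_bool (cell j x = cell j y))"
    unfolding sum_distrib_left[symmetric, of 4] by (intro arg_cong2[where f="(*)"] refl sum.swap)
  also have "\<dots> = 4 * (\<Sum>j\<le>J. (1/4) ^ j * (4::real) ^ j)"
    by (intro arg_cong2[where f="(*)"] refl sum.cong)
       (simp add: sum_distrib_left[symmetric] sum_same_cell[OF _ assms])
  also have "\<dots> = 4 * (real J + 1)"
    by (simp add: power_mult_distrib[symmetric])
  finally show ?thesis .
qed

lemma weighted_Cauchy_Schwarz: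
  fixes p q :: "'i \<Rightarrow> real"
  assumes "\<And>i. i \<in> I \<Longrightarrow> 0 \<le> p i"
  shows "(\<Sum>i\<in>I. p i * q i)\<^sup>2 \<le> (\<Sum>i\<in>I. p i) * (\<Sum>i\<in>I. p i * (q i)\<^sup>2)"
proof -
  have "(\<Sum>i\<in>I. sqrt (p i) * (sqrt (p i) * q i))\<^sup>2
      \<le> (\<Sum>i\<in>I. (sqrt (p i))\<^sup>2) * (\<Sum>i\<in>I. (sqrt (p i) * q i)\<^sup>2)"
    by (rule Cauchy_Schwarz_ineq_sum)
  moreover have "(\<Sum>i\<in>I. sqrt (p i) * (sqrt (p i) * q i)) = (\<Sum>i\<in>I. p i * q i)"
    using assms by (intro sum.cong refl) (metis mult.assoc real_sqrt_mult_self abs_of_nonneg)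
  moreover have "(\<Sum>i\<in>I. (sqrt (p i))\<^sup>2) = (\<Sum>i\<in>I. p i)"
    using assms by (intro sum.cong refl) simp
  moreover have "(\<Sum>i\<in>I. (sqrt (p i) * q i)\<^sup>2) = (\<Sum>i\<in>I. p i * (q i)\<^sup>2)"
    using assms by (intro sum.cong refl) (simp add: power_mult_distrib)
  ultimately show ?thesis by simp
qed

text \<open>After expanding the square, a pair of sites of \<open>U\<close> in one cell of level
  \<open>i\<close> is counted once for each of the \<open>4 ^ i\<close> sites of that cell, which
  lies inside the tile as \<open>i <= j\<close>.\<close>

lemma sum_row_square:
  assumes "i \<le> j" "U \<subseteq> tile j a"
  shows "(\<Sum>x\<in>tile j a. (\<Sum>y\<in>U. of_bool (cell i x = cell i y))\<^sup>2) = 4 ^ i * same_cells i U"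
proof -
  have "(\<Sum>x\<in>tile j a. (\<Sum>y\<in>U. of_bool (cell i x = cell i y) :: real)\<^sup>2)
      = (\<Sum>x\<in>tile j a. \<Sum>y\<in>U. \<Sum>z\<in>U. of_bool (cell i x = cell i y) * of_bool (cell i x = cell i z))"
    by (simp only: power2_eq_square sum_product)
  also have "\<dots> = (\<Sum>y\<in>U. \<Sum>z\<in>U. \<Sum>x\<in>tile j a.
      of_bool (cell i x = cell i y) * of_bool (cell i x = cell i z))"
    by (subst sum.swap, intro sum.cong refl sum.swap)
  also have "\<dots> = (\<Sum>y\<in>U. \<Sum>z\<in>U. \<Sum>x\<in>tile j a.
      of_bool (cell i y = cell i x) * of_bool (cell i y = cell i z))"
    by (intro sum.cong refl) (auto simp: of_bool_def)
  also have "\<dots> = (\<Sum>y\<in>U. \<Sum>z\<in>U. 4 ^ i * of_bool (cell i y = cell i z))"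
    using assms by (intro sum.cong refl) (simp add: sum_distrib_right[symmetric] sum_same_cell[OF assms(1) subsetD[OF assms(2)]])
  finally show ?thesis by (simp only: same_cells_def sum_distrib_left)
qed

text \<open>The kernel is positive semidefinite with operator norm at most \<open>2 * 2 ^ J\<close>.\<close>

lemma sum_row_dyadic_kernel_square:
  assumes "U \<subseteq> tile J a"
  shows "(\<Sum>x\<in>tile J a. (\<Sum>y\<in>U. dyadic_kernel J x y)\<^sup>2) \<le> 2 * 2 ^ J * energy J U"
proof -
  define n where "n j x = (\<Sum>y\<in>U. of_bool (cell j x = cell j y) :: real)" for j x
  have "(\<Sum>y\<in>U. dyadic_kernel J x y)\<^sup>2 \<le> 2 * 2 ^ J * (\<Sum>j\<le>J. (1/8) ^ j * (n j x)\<^sup>2)" for x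
  proof -
    have "(\<Sum>y\<in>U. dyadic_kernel J x y) = (\<Sum>j\<le>J. (1/2) ^ j * n j x)"
      unfolding dyadic_kernel_def n_def sum_distrib_left by (rule sum.swap)
    \<comment> \<open>Writing \<open>(1/2) ^ j\<close> as \<open>2 ^ j * (1/4) ^ j\<close> supplies
      the weights \<open>2 ^ j\<close> for Cauchy-Schwarz; their total is below
      \<open>2 * 2 ^ J\<close>.\<close>
    also have "\<dots> = (\<Sum>j\<le>J. 2 ^ j * ((1/4) ^ j * n j x))"
      by (simp add: mult.assoc[symmetric] power_mult_distrib[symmetric])
    also have "\<dots>\<^sup>2 \<le> (\<Sum>j\<le>J. 2 ^ j) * (\<Sum>j\<le>J. 2 ^ j * ((1/4) ^ j * n j x)\<^sup>2)"
      by (rule weighted_Cauchy_Schwarz) simp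
    also have "\<dots> \<le> 2 * 2 ^ J * (\<Sum>j\<le>J. 2 ^ j * ((1/4) ^ j * n j x)\<^sup>2)"
      by (intro mult_right_mono sum_nonneg) (auto simp: sum_gp0)
    also have "(\<Sum>j\<le>J. 2 ^ j * ((1/4) ^ j * n j x)\<^sup>2) = (\<Sum>j\<le>J. (1/8) ^ j * (n j x)\<^sup>2)"
    proof (intro sum.cong refl)
      fix j :: nat
      have "2 ^ j * ((1/4::real) ^ j * (1/4) ^ j) = (1/8) ^ j"
        by (simp only: power_mult_distrib[symmetric]) simp
      then show "2 ^ j * ((1/4) ^ j * n j x)\<^sup>2 = (1/8) ^ j * (n j x)\<^sup>2"
        by (simp add: power2_eq_square mult_ac)
    qed
    finally show ?thesis .
  qed
  moreover have eq: "(1/8) ^ j * (\<Sum>x\<in>tile J a. (n j x)\<^sup>2) = (1/2) ^ j * same_cells j U"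
    if "j \<le> J" for j
  proof -
    have "(\<Sum>x\<in>tile J a. (n j x)\<^sup>2) = 4 ^ j * same_cells j U"
      unfolding n_def using assms that by (intro sum_row_square) auto
    moreover have "(1/8::real) ^ j * 4 ^ j = (1/2) ^ j"
      by (simp only: power_mult_distrib[symmetric]) simp
    ultimately show ?thesis by (simp add: mult.assoc[symmetric])
  qed
  ultimately have "(\<Sum>x\<in>tile J a. (\<Sum>y\<in>U. dyadic_kernel J x y)\<^sup>2)
      \<le> (\<Sum>x\<in>tile J a. 2 * 2 ^ J * (\<Sum>j\<le>J. (1/8) ^ j * (n j x)\<^sup>2))"
    by (blast intro: sum_mono)
  also have "\<dots> = 2 * 2 ^ J * (\<Sum>j\<le>J. (1/8) ^ j * (\<Sum>x\<in>tile J a. (n j x)\<^sup>2))"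
    unfolding sum_distrib_left[symmetric, of "2 * 2 ^ J"] sum_distrib_left[symmetric, of "(1/8) ^ _"]
    by (subst sum.swap) (simp only: sum_distrib_left)
  also have "\<dots> = 2 * 2 ^ J * (\<Sum>j\<le>J. (1/2) ^ j * same_cells j U)"
    by (intro arg_cong2[where f="(*)"] refl sum.cong eq) simp
  finally show ?thesis by (simp add: energy_altdef)
qed

text \<open>Two sites of a tile always share their cell of level \<open>J\<close>, so the last term
  of the kernel is present for every pair. When the energy is large, this makes the number of sites,
  and with it the diagonal, small in comparison.\<close>

lemma card_square_le_energy:
  assumes "U \<subseteq> tile J a"
  shows "(real (card U))\<^sup>2 \<le> 2 ^ J * energy J U"
proof -
  have "(1/2) ^ J \<le> dyadic_kernel J x y" if "x \<in> U" "y \<in> U" for x y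
  proof -
    have "cell J x = cell J y" using that assms by (auto simp: tile_def)
    then have "(1/2) ^ J = (1/2) ^ J * (of_bool (cell J x = cell J y) :: real)" by simp
    also have "\<dots> \<le> dyadic_kernel J x y"
      unfolding dyadic_kernel_def by (rule member_le_sum) auto
    finally show ?thesis .
  qed
  then have "(\<Sum>x\<in>U. \<Sum>y\<in>U. (1/2) ^ J) \<le> energy J U"
    unfolding energy_def by (intro sum_mono)
  then show ?thesis by (simp add: power2_eq_square field_simps)
qed

text \<open>Cauchy-Schwarz over the occupied cells: few cells force many pairs into a common
  cell.\<close>

lemma card_square_le_same_cells:
  assumes "finite W"
  shows "(real (card W))\<^sup>2 \<le> real (card (cell j ` W)) * same_cells j W"
proof -
  define n where "n c = real (card {x \<in> W. cell j x = c})" for c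
  have sum: "(\<Sum>x\<in>W. g (cell j x)) = (\<Sum>c\<in>cell j ` W. n c * g c)" for g :: "_ \<Rightarrow> real"
    using assms by (subst sum.image_gen[OF assms, of _ "cell j"]) (auto simp: n_def intro!: sum.cong)
  have "real (card W) = (\<Sum>c\<in>cell j ` W. n c)"
    using sum[of "\<lambda>_. 1"] by simp
  then have "(real (card W))\<^sup>2 \<le> real (card (cell j ` W)) * (\<Sum>c\<in>cell j ` W. (n c)\<^sup>2)"
    using sum_squared_le_sum_of_squares[of n "cell j ` W"] assms by (simp add: mult.commute)
  also have "(\<Sum>c\<in>cell j ` W. (n c)\<^sup>2) = (\<Sum>x\<in>W. n (cell j x))"
    by (simp add: sum power2_eq_square)
  also have "\<dots> = same_cells j W"
    unfolding same_cells_def n_def using assms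
    by (intro sum.cong refl) (auto simp: of_bool_def sum.If_cases intro!: arg_cong[where f=card])
  finally show ?thesis .
qed

lemma same_cells_mono: "W \<subseteq> U \<Longrightarrow> finite U \<Longrightarrow> same_cells j W \<le> same_cells j U"
  unfolding same_cells_def sum.cartesian_product by (rule sum_mono2) auto

text \<open>\<open>W\<close> stands for the part in one tile of a path segment of length
  \<open>2 ^ J\<close>. It meets at most \<open>4 * 2 ^ (J - j)\<close> cells of level
  \<open>j\<close>, so by Cauchy-Schwarz each level contributes at least \<open>2 ^ J / 64\<close>;
  summing over the levels gives the logarithmic gain \<open>J + 1\<close>.\<close>

lemma energy_ge:
  assumes "finite U" "W \<subseteq> U" and W: "2 ^ J \<le> 4 * card W"
    and cells: "\<And>j. j \<le> J \<Longrightarrow> card (cell j ` W) * 2 ^ j \<le> 4 * 2 ^ J"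
  shows "2 ^ J * (real J + 1) / 64 \<le> energy J U"
proof -
  have finW: "finite W" using assms finite_subset by auto
  have "2 ^ J / 64 \<le> (1/2) ^ j * same_cells j U" if "j \<le> J" for j
  proof -
    have W': "(2::real) ^ J \<le> 4 * real (card W)"
      using of_nat_mono[OF W, where 'a = real] by simp
    have c: "real (card (cell j ` W)) * 2 ^ j \<le> 4 * 2 ^ J"
      using of_nat_mono[OF cells[OF that], where 'a = real] by simp
    have s0: "0 \<le> same_cells j W" by (auto simp: same_cells_def intro!: sum_nonneg)
    have "((2::real) ^ J)\<^sup>2 \<le> (4 * real (card W))\<^sup>2" using W' by (intro power_mono) auto
    also have "\<dots> = 16 * (real (card W))\<^sup>2" by (simp add: power_mult_distrib)
    also have "\<dots> \<le> 16 * (real (card (cell j ` W)) * same_cells j W)"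
      using card_square_le_same_cells[OF finW] by simp
    finally have "((2::real) ^ J)\<^sup>2 * 2 ^ j \<le> 16 * (real (card (cell j ` W)) * same_cells j W) * 2 ^ j"
      by (intro mult_right_mono) auto
    also have "\<dots> = 16 * same_cells j W * (real (card (cell j ` W)) * 2 ^ j)" by simp
    also have "\<dots> \<le> 16 * same_cells j W * (4 * 2 ^ J)"
      using c s0 by (intro mult_left_mono) auto
    finally have "(2 ^ J * 2 ^ j) * 2 ^ J \<le> (64 * same_cells j W) * (2::real) ^ J"
      by (simp add: power2_eq_square mult_ac)
    then have "2 ^ J * 2 ^ j \<le> 64 * same_cells j W"
      by (rule mult_right_le_imp_le) simp
    also have "\<dots> \<le> 64 * same_cells j U"
      using same_cells_mono assms by simp
    finally show ?thesis by (simp add: field_simps)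
  qed
  then have "(\<Sum>j\<le>J. 2 ^ J / 64) \<le> energy J U"
    unfolding energy_altdef by (intro sum_mono) auto
  then show ?thesis by (simp add: algebra_simps)
qed

section \<open>Coarse graining of self-avoiding paths\<close>

definition nbhd :: "int \<times> int \<Rightarrow> (int \<times> int) set" where
  "nbhd a = {fst a - 1..fst a + 1} \<times> {snd a - 1..snd a + 1}"

lemma finite_nbhd [simp]: "finite (nbhd a)"
  by (simp add: nbhd_def)

lemma card_nbhd: "card (nbhd a) = 9"
  by (simp add: nbhd_def card_cartesian_product)

lemma nbhd_sym: "a \<in> nbhd b \<longleftrightarrow> b \<in> nbhd a"
  by (cases a; cases b) (auto simp: nbhd_def)

lemma nbhd_cell:
  assumes "\<bar>fst x - fst y\<bar> \<le> 2 ^ j" "\<bar>snd x - snd y\<bar> \<le> 2 ^ j"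
  shows "cell j y \<in> nbhd (cell j x)"
proof -
  have "\<bar>a div 2 ^ j - b div 2 ^ j\<bar> \<le> 1" if "\<bar>a - b\<bar> \<le> 2 ^ j" for a b :: int
  proof -
    have "a div 2 ^ j \<le> (b + 2 ^ j) div 2 ^ j" "b div 2 ^ j \<le> (a + 2 ^ j) div 2 ^ j"
      using that by (intro zdiv_mono1; simp)+
    then show ?thesis by simp
  qed
  from this[OF assms(1)] this[OF assms(2)] show ?thesis
    by (auto simp: nbhd_def cell_def)
qed

lemma saw_dist:
  assumes "S \<in> saws N" "s \<le> t" "t \<le> N"
  shows "\<bar>fst (S t) - fst (S s)\<bar> \<le> int (t - s)" "\<bar>snd (S t) - snd (S s)\<bar> \<le> int (t - s)"
proof -
  have "s + d \<le> N \<Longrightarrow>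
      \<bar>fst (S (s + d)) - fst (S s)\<bar> \<le> int d \<and> \<bar>snd (S (s + d)) - snd (S s)\<bar> \<le> int d" for d
  proof (induction d)
    case (Suc d)
    have "lattice_adj (S (s + d)) (S (Suc (s + d)))"
      using assms(1) Suc.prems by (simp add: saws_def)
    then have "\<bar>fst (S (Suc (s + d))) - fst (S (s + d))\<bar> \<le> 1"
      "\<bar>snd (S (Suc (s + d))) - snd (S (s + d))\<bar> \<le> 1"
      by (auto simp: lattice_adj_def)
    moreover have "\<bar>fst (S (s + d)) - fst (S s)\<bar> \<le> int d \<and> \<bar>snd (S (s + d)) - snd (S s)\<bar> \<le> int d"
      using Suc by simp
    ultimately have "\<bar>fst (S (Suc (s + d))) - fst (S s)\<bar> \<le> int (Suc d)"
      "\<bar>snd (S (Suc (s + d))) - snd (S s)\<bar> \<le> int (Suc d)" by linarith+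
    then show ?case by simp
  qed simp
  from this[of "t - s"] assms
  show "\<bar>fst (S t) - fst (S s)\<bar> \<le> int (t - s)" "\<bar>snd (S t) - snd (S s)\<bar> \<le> int (t - s)"
    by auto
qed

lemma saw_run_dist:
  assumes "S \<in> saws N" "t + m \<le> N + 1" "u \<in> {t..<t + m}" "v \<in> {t..<t + m}"
  shows "\<bar>fst (S u) - fst (S v)\<bar> < int m" "\<bar>snd (S u) - snd (S v)\<bar> < int m"
  using saw_dist[OF assms(1), of u v] saw_dist[OF assms(1), of v u] assms(2-4)
  by (cases "u \<le> v"; force)+

lemma card_div_le_2:
  fixes A :: "int set"
  assumes "finite A" and "\<And>x y. x \<in> A \<Longrightarrow> y \<in> A \<Longrightarrow> \<bar>x - y\<bar> < m"
  shows "\<exists>q. (\<lambda>x. x div m) ` A \<subseteq> {q, q + 1}"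
proof (cases "A = {}")
  case False
  define a where "a = Min A"
  have a: "a \<in> A" "\<And>x. x \<in> A \<Longrightarrow> a \<le> x" using assms(1) False by (auto simp: a_def)
  then have m: "m > 0" using assms(2)[of a a] by simp
  have "x div m \<in> {a div m, a div m + 1}" if "x \<in> A" for x
  proof -
    have "a div m \<le> x div m" using a(2)[OF that] m by (intro zdiv_mono1)
    moreover have "x div m \<le> (a + m) div m"
      using assms(2)[OF that a(1)] m by (intro zdiv_mono1) auto
    ultimately show ?thesis using m by auto
  qed
  then show ?thesis by blast
qed simp

text \<open>Along \<open>2 ^ j\<close> consecutive sites each coordinate varies by less than
  \<open>2 ^ j\<close>, hence meets at most two dyadic intervals of that length.\<close>

lemma card_cells_run:
  assumes "S \<in> saws N" "t + 2 ^ j \<le> N + 1"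
  shows "card (cell j ` S ` {t..<t + 2 ^ j}) \<le> 4"
proof -
  let ?R = "{t..<t + 2 ^ j}"
  have d: "\<bar>fst (S u) - fst (S v)\<bar> < 2 ^ j" "\<bar>snd (S u) - snd (S v)\<bar> < 2 ^ j"
    if "u \<in> ?R" "v \<in> ?R" for u v
    using saw_run_dist[OF assms that] by simp_all
  have fin: "finite ((\<lambda>u. fst (S u)) ` ?R)" "finite ((\<lambda>u. snd (S u)) ` ?R)" by simp_all
  obtain p where p: "(\<lambda>x. x div 2 ^ j) ` (\<lambda>u. fst (S u)) ` ?R \<subseteq> {p, p + 1}"
    using card_div_le_2[of "(\<lambda>u. fst (S u)) ` ?R" "2 ^ j"] fin d(1) by blast
  obtain q where q: "(\<lambda>x. x div 2 ^ j) ` (\<lambda>u. snd (S u)) ` ?R \<subseteq> {q, q + 1}"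
    using card_div_le_2[of "(\<lambda>u. snd (S u)) ` ?R" "2 ^ j"] fin d(2) by blast
  have "cell j ` S ` ?R \<subseteq> {p, p + 1} \<times> {q, q + 1}"
  proof
    fix c assume "c \<in> cell j ` S ` ?R"
    then obtain u where u: "u \<in> ?R" "c = cell j (S u)" by blast
    have "fst (S u) div 2 ^ j \<in> {p, p + 1}" "snd (S u) div 2 ^ j \<in> {q, q + 1}"
      using subsetD[OF p] subsetD[OF q] u(1) by blast+
    then show "c \<in> {p, p + 1} \<times> {q, q + 1}" unfolding u(2) cell_def by blast
  qed
  then have "card (cell j ` S ` ?R) \<le> card ({p, p + 1} \<times> {q, q + 1})"
    by (intro card_mono) auto
  also have "\<dots> = 4" by (simp add: card_cartesian_product)
  finally show ?thesis .
qed

text \<open>The segment is cut into \<open>2 ^ (J - j)\<close> runs of \<open>2 ^ j\<close> sites,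
  each meeting at most four cells.\<close>

lemma card_cells_segment:
  assumes "S \<in> saws N" "t + 2 ^ J \<le> N + 1" "j \<le> J"
  shows "card (cell j ` S ` {t..<t + 2 ^ J}) * 2 ^ j \<le> 4 * 2 ^ J"
proof -
  have J: "(2::nat) ^ J = 2 ^ (J - j) * 2 ^ j" using assms(3) by (simp add: power_add[symmetric])
  have "{t..<t + 2 ^ J} \<subseteq> (\<Union>i<2 ^ (J - j). {t + i * 2 ^ j..<(t + i * 2 ^ j) + 2 ^ j})"
  proof
    fix u assume u: "u \<in> {t..<t + 2 ^ J}"
    define i where "i = (u - t) div 2 ^ j"
    have "i < 2 ^ (J - j)" unfolding i_def by (rule less_mult_imp_div_less) (use u J in auto)
    moreover have "u - t = i * 2 ^ j + (u - t) mod 2 ^ j" unfolding i_def by (simp only: div_mult_mod_eq)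
    moreover have "(u - t) mod 2 ^ j < 2 ^ j" by simp
    moreover have "t \<le> u" using u by simp
    ultimately have "i < 2 ^ (J - j)" "t + i * 2 ^ j \<le> u" "u < (t + i * 2 ^ j) + 2 ^ j"
      by linarith+
    then show "u \<in> (\<Union>i<2 ^ (J - j). {t + i * 2 ^ j..<(t + i * 2 ^ j) + 2 ^ j})"
      by (intro UN_I[of i]) auto
  qed
  then have "cell j ` S ` {t..<t + 2 ^ J}
      \<subseteq> (\<Union>i<2 ^ (J - j). cell j ` S ` {t + i * 2 ^ j..<(t + i * 2 ^ j) + 2 ^ j})"
    by blast
  then have "card (cell j ` S ` {t..<t + 2 ^ J})
      \<le> card (\<Union>i<2 ^ (J - j). cell j ` S ` {t + i * 2 ^ j..<(t + i * 2 ^ j) + 2 ^ j})"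
    by (intro card_mono) auto
  also have "\<dots> \<le> (\<Sum>i<2 ^ (J - j). card (cell j ` S ` {t + i * 2 ^ j..<(t + i * 2 ^ j) + 2 ^ j}))"
    by (rule card_UN_le) simp
  also have "\<dots> \<le> (\<Sum>i<(2::nat) ^ (J - j). 4)"
  proof (intro sum_mono card_cells_run[OF assms(1)])
    fix i :: nat assume "i \<in> {..<2 ^ (J - j)}"
    then have "Suc i * 2 ^ j \<le> 2 ^ (J - j) * 2 ^ j" by (intro mult_right_mono) auto
    then show "t + i * 2 ^ j + 2 ^ j \<le> N + 1" using assms(2) J by simp
  qed
  finally have "card (cell j ` S ` {t..<t + 2 ^ J}) \<le> 2 ^ (J - j) * 4" by simp
  then have "card (cell j ` S ` {t..<t + 2 ^ J}) * 2 ^ j \<le> (2 ^ (J - j) * 4) * 2 ^ j"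
    by (rule mult_right_mono) simp
  then show ?thesis using J by simp
qed

section \<open>Visited and well visited tiles\<close>

definition segment :: "nat \<Rightarrow> nat \<Rightarrow> nat set" where
  "segment J i = {i * 2 ^ J..<i * 2 ^ J + 2 ^ J}"

definition visited :: "nat \<Rightarrow> (nat \<Rightarrow> int \<times> int) \<Rightarrow> nat \<Rightarrow> (int \<times> int) set" where
  "visited J S q = cell J ` S ` {..<q * 2 ^ J}"

text \<open>A segment meets at most four tiles, so one of them contains a quarter of its times; this
  is the share of a single segment that \<open>energy_ge\<close> requires.\<close>

definition well_visited :: "nat \<Rightarrow> (nat \<Rightarrow> int \<times> int) \<Rightarrow> nat \<Rightarrow> (int \<times> int) set" where
  "well_visited J S q = {a. \<exists>i<q. 2 ^ J \<le> 4 * card {t \<in> segment J i. cell J (S t) = a}}"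

lemma finite_visited [simp]: "finite (visited J S q)"
  by (simp add: visited_def)

lemma segment_less:
  assumes "i < q" "t \<in> segment J i"
  shows "t < q * 2 ^ J"
proof -
  have "Suc i * 2 ^ J \<le> q * 2 ^ J" using assms(1) by (intro mult_right_mono) auto
  then show ?thesis using assms(2) by (auto simp: segment_def)
qed

lemma well_visited_subset: "well_visited J S q \<subseteq> visited J S q"
proof
  fix a assume "a \<in> well_visited J S q"
  then obtain i where i: "i < q" "2 ^ J \<le> 4 * card {t \<in> segment J i. cell J (S t) = a}"
    by (auto simp: well_visited_def)
  have "(2::nat) ^ J > 0" by simp
  with i(2) have "{t \<in> segment J i. cell J (S t) = a} \<noteq> {}" by (metis card.empty mult_0_right not_le)
  then obtain t where t: "t \<in> segment J i" "cell J (S t) = a" by blast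
  then show "a \<in> visited J S q"
    using segment_less[OF i(1) t(1)] by (auto simp: visited_def)
qed

text \<open>Each tile met by a segment neighbours the tile that holds a quarter of that same
  segment, and a tile has nine neighbours, itself included.\<close>

lemma card_visited_le:
  assumes S: "S \<in> saws N" and q: "q * 2 ^ J \<le> N + 1"
  shows "card (visited J S q) \<le> 9 * card (well_visited J S q)"
proof -
  have fin: "finite (well_visited J S q)"
    by (rule finite_subset[OF well_visited_subset]) simp
  have "visited J S q \<subseteq> (\<Union>a\<in>well_visited J S q. nbhd a)"
  proof
    fix b assume "b \<in> visited J S q"
    then obtain u where u: "u < q * 2 ^ J" "b = cell J (S u)" by (auto simp: visited_def)
    define i where "i = u div 2 ^ J"
    have iq: "i < q" using u(1) by (simp add: i_def less_mult_imp_div_less)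
    have "u = i * 2 ^ J + u mod 2 ^ J" unfolding i_def by (simp only: div_mult_mod_eq)
    moreover have "u mod 2 ^ J < 2 ^ J" by simp
    ultimately have "i * 2 ^ J \<le> u" "u < i * 2 ^ J + 2 ^ J" by linarith+
    then have ui: "u \<in> segment J i" unfolding segment_def by simp
    have "Suc i * 2 ^ J \<le> q * 2 ^ J" using iq by (intro mult_right_mono) auto
    then have seg: "i * 2 ^ J + 2 ^ J \<le> N + 1" using q by simp
    let ?C = "cell J ` S ` segment J i"
    have "\<exists>a\<in>?C. 2 ^ J \<le> 4 * card {t \<in> segment J i. cell J (S t) = a}"
    proof (rule ccontr)
      assume "\<not> ?thesis"
      then have less: "4 * card {t \<in> segment J i. cell J (S t) = a} < 2 ^ J" if "a \<in> ?C" for a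
        using that by force
      have "4 * 2 ^ J = 4 * card (segment J i)" by (simp add: segment_def)
      also have "card (segment J i) = card (\<Union>a\<in>?C. {t \<in> segment J i. cell J (S t) = a})"
        by (rule arg_cong[of _ _ card]) blast
      also have "\<dots> \<le> (\<Sum>a\<in>?C. card {t \<in> segment J i. cell J (S t) = a})"
        by (rule card_UN_le) (simp add: segment_def)
      also have "4 * (\<Sum>a\<in>?C. card {t \<in> segment J i. cell J (S t) = a})
          = (\<Sum>a\<in>?C. 4 * card {t \<in> segment J i. cell J (S t) = a})" by (rule sum_distrib_left)
      also have "\<dots> < (\<Sum>a\<in>?C. 2 ^ J)"
        by (rule sum_strict_mono) (use less ui in \<open>auto simp: segment_def\<close>)
      also have "\<dots> \<le> 4 * 2 ^ J"
        using card_cells_run[OF S seg] by (simp add: segment_def)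
      finally show False by simp
    qed
    then obtain v where v: "v \<in> segment J i"
      "2 ^ J \<le> 4 * card {t \<in> segment J i. cell J (S t) = cell J (S v)}" by blast
    then have "cell J (S v) \<in> well_visited J S q" using iq by (auto simp: well_visited_def)
    moreover have "b \<in> nbhd (cell J (S v))"
      unfolding u(2) using saw_run_dist[OF S seg, of v u] ui v(1)
      by (intro nbhd_cell) (auto simp: segment_def)
    ultimately show "b \<in> (\<Union>a\<in>well_visited J S q. nbhd a)" by blast
  qed
  then have "card (visited J S q) \<le> card (\<Union>a\<in>well_visited J S q. nbhd a)"
    using fin by (intro card_mono) auto
  also have "\<dots> \<le> (\<Sum>a\<in>well_visited J S q. card (nbhd a))"
    by (rule card_UN_le[OF fin])
  finally show ?thesis by (simp add: card_nbhd)
qed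

text \<open>Self-avoidance enters here: \<open>q * 2 ^ J\<close> distinct sites have to fit into
  visited tiles of \<open>4 ^ J\<close> sites each.\<close>

lemma card_visited_ge:
  assumes S: "S \<in> saws N" and q: "q * 2 ^ J \<le> N + 1"
  shows "q \<le> card (visited J S q) * 2 ^ J"
proof -
  have inj: "inj_on S {..<q * 2 ^ J}"
    using S q by (auto simp: saws_def intro: inj_on_subset)
  have "q * 2 ^ J = card (S ` {..<q * 2 ^ J})" by (simp add: card_image[OF inj])
  also have "\<dots> \<le> card (\<Union>a\<in>visited J S q. tile J a)"
    by (intro card_mono finite_UN_I finite_visited finite_tile) (auto simp: visited_def tile_def)
  also have "\<dots> \<le> (\<Sum>a\<in>visited J S q. card (tile J a))"
    by (rule card_UN_le) simp
  also have "\<dots> = card (visited J S q) * 4 ^ J" by (simp add: card_tile)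
  also have "(4::nat) ^ J = 2 ^ J * 2 ^ J" by (simp add: power_mult_distrib[symmetric])
  finally have "q * 2 ^ J \<le> card (visited J S q) * 2 ^ J * 2 ^ J" by (simp add: mult.assoc)
  then show ?thesis by simp
qed

lemma well_visited_energy:
  assumes S: "S \<in> saws N" and q: "q * 2 ^ J \<le> N + 1" and a: "a \<in> well_visited J S q"
  shows "2 ^ J * (real J + 1) / 64 \<le> energy J (S ` {0..N} \<inter> tile J a)"
proof -
  obtain i where i: "i < q" "2 ^ J \<le> 4 * card {t \<in> segment J i. cell J (S t) = a}"
    using a by (auto simp: well_visited_def)
  have "Suc i * 2 ^ J \<le> q * 2 ^ J" using i(1) by (intro mult_right_mono) auto
  then have seg: "i * 2 ^ J + 2 ^ J \<le> N + 1" using q by simp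
  let ?T = "{t \<in> segment J i. cell J (S t) = a}"
  have sub: "?T \<subseteq> {0..N}" using seg by (auto simp: segment_def)
  have inj: "inj_on S ?T" using S sub by (auto simp: saws_def intro: inj_on_subset)
  show ?thesis
  proof (rule energy_ge)
    show "S ` ?T \<subseteq> S ` {0..N} \<inter> tile J a" using sub by (auto simp: tile_def)
    show "2 ^ J \<le> 4 * card (S ` ?T)" using i(2) by (simp add: card_image[OF inj])
    fix j assume j: "j \<le> J"
    have "card (cell j ` S ` ?T) * 2 ^ j \<le> card (cell j ` S ` segment J i) * 2 ^ j"
      by (intro mult_right_mono card_mono) (auto simp: segment_def)
    also have "\<dots> \<le> 4 * 2 ^ J"
      unfolding segment_def by (rule card_cells_segment[OF S seg j])
    finally show "card (cell j ` S ` ?T) * 2 ^ j \<le> 4 * 2 ^ J" .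
  qed simp
qed

section \<open>Covering the visited tiles by short walks\<close>

definition walks :: "int \<times> int \<Rightarrow> nat \<Rightarrow> (int \<times> int) list set" where
  "walks a n = {xs. length xs = Suc n \<and> hd xs = a \<and> successively (\<lambda>x y. y \<in> nbhd x) xs}"

lemma walks_Suc: "walks a (Suc n) \<subseteq> (\<Union>b\<in>nbhd a. (#) a ` walks b n)"
proof
  fix xs assume xs: "xs \<in> walks a (Suc n)"
  then obtain ys where ys: "xs = a # ys" "length ys = Suc n"
    by (auto simp: walks_def length_Suc_conv)
  then have "ys \<in> walks (hd ys) n" "hd ys \<in> nbhd a"
    using xs by (cases ys; auto simp: walks_def)+
  then show "xs \<in> (\<Union>b\<in>nbhd a. (#) a ` walks b n)" using ys(1) by blast
qed

lemma finite_card_walks: "finite (walks a n) \<and> card (walks a n) \<le> 9 ^ n"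
proof (induction n arbitrary: a)
  case 0
  have "walks a 0 = {[a]}" by (auto simp: walks_def length_Suc_conv)
  then show ?case by simp
next
  case (Suc n)
  have fin: "finite (\<Union>b\<in>nbhd a. (#) a ` walks b n)" using Suc by simp
  have "card (walks a (Suc n)) \<le> card (\<Union>b\<in>nbhd a. (#) a ` walks b n)"
    by (rule card_mono[OF fin walks_Suc])
  also have "\<dots> \<le> (\<Sum>b\<in>nbhd a. card ((#) a ` walks b n))"
    by (rule card_UN_le) simp
  also have "\<dots> \<le> (\<Sum>b\<in>nbhd a. 9 ^ n)"
    using Suc by (intro sum_mono) (simp add: card_image)
  finally show ?case using finite_subset[OF walks_Suc fin] by (simp add: card_nbhd)
qed

text \<open>Each new site is inserted into the walk as a detour of two steps from its predecessor,
  as in the depth-first traversal of a spanning tree.\<close>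

lemma trace_covering_walk:
  assumes "\<And>t. t < n \<Longrightarrow> b (Suc t) \<in> nbhd (b t)"
  shows "\<exists>xs\<in>walks (b 0) (2 * (card (b ` {..n}) - 1)). set xs = b ` {..n}"
  using assms
proof (induction n)
  case 0
  have "[b 0] \<in> walks (b 0) 0" by (simp add: walks_def)
  then show ?case by (intro bexI[of _ "[b 0]"]) auto
next
  case (Suc n)
  obtain xs where xs: "xs \<in> walks (b 0) (2 * (card (b ` {..n}) - 1))" "set xs = b ` {..n}"
    using Suc.IH Suc.prems by auto
  have img: "b ` {..Suc n} = insert (b (Suc n)) (b ` {..n})" by (simp add: atMost_Suc)
  show ?case
  proof (cases "b (Suc n) \<in> b ` {..n}")
    case True
    then have "b ` {..Suc n} = b ` {..n}" unfolding img by (rule insert_absorb)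
    then show ?thesis using xs by auto
  next
    case False
    have "b n \<in> set xs" using xs(2) by auto
    then obtain us vs where uv: "xs = us @ b n # vs" by (auto simp: in_set_conv_decomp)
    define ys where "ys = us @ b n # b (Suc n) # b n # vs"
    have step: "b (Suc n) \<in> nbhd (b n)" using Suc.prems by simp
    have len: "length xs = Suc (2 * (card (b ` {..n}) - 1))" using xs(1) by (simp add: walks_def)
    have "card (b ` {..n}) > 0" by (simp add: card_gt_0_iff)
    then have "length ys = Suc (2 * (card (b ` {..Suc n}) - 1))"
      using len False unfolding img by (simp add: ys_def uv)
    moreover have "hd ys = b 0" using xs(1) by (cases us) (auto simp: walks_def ys_def uv)
    moreover have "successively (\<lambda>x y. y \<in> nbhd x) ys"
      using xs(1) step nbhd_sym[of "b n"]
      by (auto simp: walks_def ys_def uv successively_append_iff successively_Cons)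
    ultimately have "ys \<in> walks (b 0) (2 * (card (b ` {..Suc n}) - 1))"
      unfolding walks_def by simp
    moreover have "set ys = b ` {..Suc n}"
      using xs(2) unfolding img by (auto simp: ys_def uv)
    ultimately show ?thesis by blast
  qed
qed

text \<open>For the union bound, the possible sets of \<open>k\<close> visited tiles are thereby
  enumerated by walks of \<open>2 * (k - 1)\<close> steps, of which there are at most
  \<open>9 ^ (2 * (k - 1))\<close>.\<close>

lemma visited_covering_walk:
  assumes S: "S \<in> saws N" and q: "q * 2 ^ J \<le> N + 1" "q > 0"
  shows "\<exists>xs\<in>walks 0 (2 * (card (visited J S q) - 1)). set xs = visited J S q"
proof -
  have pos: "q * 2 ^ J > 0" using q by simp
  have e: "visited J S q = (\<lambda>t. cell J (S t)) ` {..q * 2 ^ J - 1}"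
  proof -
    have "q * 2 ^ J = Suc (q * 2 ^ J - 1)" using pos by simp
    then have "{..<q * 2 ^ J} = {..q * 2 ^ J - 1}" by (metis lessThan_Suc_atMost)
    then show ?thesis unfolding visited_def image_image by (rule arg_cong)
  qed
  have "cell J (S 0) = 0" using S by (simp add: saws_def cell_def zero_prod_def)
  moreover have "\<exists>xs\<in>walks (cell J (S 0)) (2 * (card ((\<lambda>t. cell J (S t)) ` {..q * 2 ^ J - 1}) - 1)).
      set xs = (\<lambda>t. cell J (S t)) ` {..q * 2 ^ J - 1}"
  proof (rule trace_covering_walk)
    fix t assume "t < q * 2 ^ J - 1"
    then have "t < N" using q by simp
    then have "\<bar>fst (S (Suc t)) - fst (S t)\<bar> \<le> 1" "\<bar>snd (S (Suc t)) - snd (S t)\<bar> \<le> 1"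
      using saw_dist[OF S, of t "Suc t"] by auto
    moreover have "(1::int) \<le> 2 ^ J" by simp
    ultimately show "cell J (S (Suc t)) \<in> nbhd (cell J (S t))"
      by (intro nbhd_cell) linarith+
  qed
  ultimately show ?thesis unfolding e by simp
qed

section \<open>Quadratic forms on tiles\<close>

lemma quadratic_form_offdiag:
  assumes "finite A"
  shows "quadratic_form V A f = (\<Sum>x\<in>A. \<Sum>y\<in>A. if x = y then 0 else V x y * f x * f y)"
proof -
  have "(\<Sum>y\<in>A - {x}. V x y * f x * f y) = (\<Sum>y\<in>A. if x = y then 0 else V x y * f x * f y)" for x
    using assms by (intro sum.mono_neutral_cong_left) auto
  then show ?thesis by (simp add: quadratic_form_def)
qed

text \<open>A field with mean \<open>m\<close> on \<open>U\<close> is split into its centered part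
  \<open>f\<close> and its mean; the form becomes a linear part, the form of \<open>f\<close> and a
  constant. The two mixed sums agree by symmetry of \<open>V\<close>.\<close>

lemma quadratic_form_shift:
  fixes V :: "'i \<Rightarrow> 'i \<Rightarrow> real"
  assumes A: "finite A" "U \<subseteq> A" and sym: "\<And>x y. V x y = V y x"
  shows "quadratic_form V A (\<lambda>x. f x + m * of_bool (x \<in> U))
    = (\<Sum>x\<in>A. 2 * m * (\<Sum>y\<in>U - {x}. V x y) * f x) + quadratic_form V A f
      + m\<^sup>2 * quadratic_form V U (\<lambda>_. 1)"
proof -
  let ?o = "\<lambda>x y. if x = y then 0 else V x y"
  let ?g = "\<lambda>x. of_bool (x \<in> U) :: real"
  have "quadratic_form V A (\<lambda>x. f x + m * ?g x)
      = (\<Sum>x\<in>A. \<Sum>y\<in>A. ?o x y * f x * f y + m * (?o x y * f x * ?g y)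
          + m * (?o x y * ?g x * f y) + m\<^sup>2 * (?o x y * ?g x * ?g y))"
    unfolding quadratic_form_offdiag[OF A(1)]
    by (intro sum.cong refl) (simp add: algebra_simps power2_eq_square)
  also have "\<dots> = (\<Sum>x\<in>A. \<Sum>y\<in>A. ?o x y * f x * f y) + m * (\<Sum>x\<in>A. \<Sum>y\<in>A. ?o x y * f x * ?g y)
      + m * (\<Sum>x\<in>A. \<Sum>y\<in>A. ?o x y * ?g x * f y) + m\<^sup>2 * (\<Sum>x\<in>A. \<Sum>y\<in>A. ?o x y * ?g x * ?g y)"
    by (simp only: sum.distrib sum_distrib_left)
  also have "(\<Sum>x\<in>A. \<Sum>y\<in>A. ?o x y * f x * f y) = quadratic_form V A f"
    unfolding quadratic_form_offdiag[OF A(1)] by (intro sum.cong refl) auto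
  also have "(\<Sum>x\<in>A. \<Sum>y\<in>A. ?o x y * ?g x * f y) = (\<Sum>x\<in>A. \<Sum>y\<in>A. ?o x y * f x * ?g y)"
    by (subst sum.swap, intro sum.cong refl) (auto simp: sym)
  also have "(\<Sum>x\<in>A. \<Sum>y\<in>A. ?o x y * f x * ?g y) = (\<Sum>x\<in>A. (\<Sum>y\<in>U - {x}. V x y) * f x)"
  proof (intro sum.cong refl)
    fix x
    have "(\<Sum>y\<in>A. ?o x y * f x * ?g y) = (\<Sum>y\<in>U - {x}. V x y * f x)"
      using A by (intro sum.mono_neutral_cong_right) (auto simp: of_bool_def)
    then show "(\<Sum>y\<in>A. ?o x y * f x * ?g y) = (\<Sum>y\<in>U - {x}. V x y) * f x"
      by (simp only: sum_distrib_right)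
  qed
  also have "(\<Sum>x\<in>A. \<Sum>y\<in>A. ?o x y * ?g x * ?g y) = quadratic_form V U (\<lambda>_. 1)"
  proof -
    have "(\<Sum>x\<in>A. \<Sum>y\<in>A. ?o x y * ?g x * ?g y) = (\<Sum>x\<in>U. \<Sum>y\<in>A. ?o x y * ?g x * ?g y)"
      using A by (intro sum.mono_neutral_right) auto
    also have "\<dots> = (\<Sum>x\<in>U. \<Sum>y\<in>U - {x}. V x y * 1 * 1)"
      using A by (intro sum.cong refl sum.mono_neutral_cong_right) (auto simp: of_bool_def)
    finally show ?thesis by (simp only: quadratic_form_def)
  qed
  finally show ?thesis by (simp add: sum_distrib_left algebra_simps)
qed

lemma quadratic_form_ge_energy:
  assumes "finite U"
  shows "energy J U - 2 * real (card U) \<le> quadratic_form (dyadic_kernel J) U (\<lambda>_. 1)"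
proof -
  have "energy J U = (\<Sum>x\<in>U. dyadic_kernel J x x + (\<Sum>y\<in>U - {x}. dyadic_kernel J x y))"
    unfolding energy_def using assms by (intro sum.cong refl sum.remove)
  also have "\<dots> = (\<Sum>x\<in>U. dyadic_kernel J x x) + quadratic_form (dyadic_kernel J) U (\<lambda>_. 1)"
    by (simp add: sum.distrib quadratic_form_def)
  also have "(\<Sum>x\<in>U. dyadic_kernel J x x) \<le> (\<Sum>x\<in>U. 2)"
    by (intro sum_mono dyadic_kernel_le_2)
  finally show ?thesis by simp
qed

definition tile_form :: "nat \<Rightarrow> (int \<times> int \<Rightarrow> 'a \<Rightarrow> real) \<Rightarrow> int \<times> int \<Rightarrow> 'a \<Rightarrow> real" where
  "tile_form J X a t = quadratic_form (dyadic_kernel J) (tile J a) (\<lambda>x. X x t)"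

lemma (in prob_space) indep_tile_form:
  assumes "indep_vars (\<lambda>_. borel) X UNIV"
  shows "indep_vars (\<lambda>_. borel) (tile_form J X) UNIV"
proof -
  define g where "g a f = quadratic_form (dyadic_kernel J) (tile J a) f"
    for a and f :: "int \<times> int \<Rightarrow> real"
  have "indep_vars (\<lambda>a. PiM (tile J a) (\<lambda>_. borel)) (\<lambda>a t. restrict (\<lambda>x. X x t) (tile J a)) UNIV"
    by (rule indep_vars_restrict[OF assms]) (auto intro: disjoint_tiles)
  moreover have "g a \<in> borel_measurable (PiM (tile J a) (\<lambda>_. borel))" for a
    unfolding g_def quadratic_form_def by measurable
  ultimately have "indep_vars (\<lambda>_. borel) (\<lambda>a t. g a (restrict (\<lambda>x. X x t) (tile J a))) UNIV"
    by (rule indep_vars_compose2)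
  moreover have "g a (restrict (\<lambda>x. X x t) (tile J a)) = tile_form J X a t" for a t
    unfolding g_def tile_form_def quadratic_form_def by (intro sum.cong refl) auto
  ultimately show ?thesis by simp
qed

text \<open>With \<open>U\<close> empty this treats the untilted field, with \<open>U\<close> the
  sites of a path in the tile the tilted one. The linear part of the centered form is controlled by
  the operator norm of the kernel, the quadratic part by its square sums.\<close>

lemma (in prob_space) tile_form_second_moment:
  fixes X :: "int \<times> int \<Rightarrow> 'a \<Rightarrow> real"
  assumes ind: "indep_vars (\<lambda>_. borel) X UNIV" and U: "U \<subseteq> tile J a"
    and int: "\<And>x. x \<in> tile J a \<Longrightarrow> integrable M (\<lambda>t. (X x t)\<^sup>2)"
    and mean: "\<And>x. x \<in> tile J a \<Longrightarrow> expectation (X x) = m * of_bool (x \<in> U)"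
    and var: "\<And>x. x \<in> tile J a \<Longrightarrow> variance (X x) \<le> s"
  defines "F \<equiv> (\<lambda>t. tile_form J X a t - m\<^sup>2 * quadratic_form (dyadic_kernel J) U (\<lambda>_. 1))"
  shows "integrable M (\<lambda>t. (F t)\<^sup>2)"
    and "expectation (\<lambda>t. (F t)\<^sup>2) \<le> 8 * s * m\<^sup>2 * 2 ^ J * energy J U + 8 * s\<^sup>2 * 4 ^ J * (real J + 1)"
proof -
  define Y where "Y x t = X x t - m * of_bool (x \<in> U)" for x t
  define c where "c x = 2 * m * (\<Sum>y\<in>U - {x}. dyadic_kernel J x y)" for x
  have [measurable]: "X x \<in> borel_measurable M" for x
    using ind unfolding indep_vars_def by blast
  have X1: "integrable M (X x)" if "x \<in> tile J a" for x
    by (rule square_integrable_imp_integrable[OF _ int[OF that]]) simp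
  have indY: "indep_vars (\<lambda>_. borel) Y (tile J a)"
    unfolding Y_def using indep_vars_compose2[OF indep_vars_subset[OF ind, of "tile J a"],
        of "\<lambda>x y. y - m * of_bool (x \<in> U)" "\<lambda>_. borel"] by simp
  have Y: "integrable M (\<lambda>t. (Y x t)\<^sup>2)" "expectation (Y x) = 0"
    "expectation (\<lambda>t. (Y x t)\<^sup>2) \<le> s" if "x \<in> tile J a" for x
  proof -
    have "(Y x t)\<^sup>2 = (X x t)\<^sup>2 - 2 * (m * of_bool (x \<in> U)) * X x t + (m * of_bool (x \<in> U))\<^sup>2" for t
      by (simp add: Y_def power2_diff)
    then show "integrable M (\<lambda>t. (Y x t)\<^sup>2)" using int[OF that] X1[OF that] by simp
    show "expectation (Y x) = 0"
      unfolding Y_def using X1[OF that] mean[OF that] by (simp add: prob_space)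
    show "expectation (\<lambda>t. (Y x t)\<^sup>2) \<le> s"
      using var[OF that] unfolding mean[OF that] Y_def .
  qed
  have F: "F t = (\<Sum>x\<in>tile J a. c x * Y x t) + quadratic_form (dyadic_kernel J) (tile J a) (\<lambda>x. Y x t)" for t
  proof -
    have "tile_form J X a t
        = quadratic_form (dyadic_kernel J) (tile J a) (\<lambda>x. Y x t + m * of_bool (x \<in> U))"
      by (simp add: tile_form_def Y_def)
    then show ?thesis
      by (simp add: F_def c_def quadratic_form_shift[OF finite_tile U dyadic_kernel_sym])
  qed
  note * = quadratic_form_second_moment[OF finite_tile indY, where c = c and V = "dyadic_kernel J",
      OF Y dyadic_kernel_sym]
  show "integrable M (\<lambda>t. (F t)\<^sup>2)" unfolding F using * by simp
  have s0: "0 \<le> s" 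
  proof -
    have "a' \<in> tile J a \<Longrightarrow> 0 \<le> s" for a'
      using Y(3)[of a'] by (rule order_trans[rotated]) simp_all
    moreover have "tile J a \<noteq> {}" using card_tile[of J a] by auto
    ultimately show ?thesis by blast
  qed
  have "(\<Sum>x\<in>tile J a. (c x)\<^sup>2) \<le> (\<Sum>x\<in>tile J a. 4 * m\<^sup>2 * (\<Sum>y\<in>U. dyadic_kernel J x y)\<^sup>2)"
  proof (intro sum_mono)
    fix x
    have "finite U" by (rule finite_subset[OF U]) simp
    then have "(\<Sum>y\<in>U - {x}. dyadic_kernel J x y)\<^sup>2 \<le> (\<Sum>y\<in>U. dyadic_kernel J x y)\<^sup>2"
      by (intro power_mono sum_mono2 sum_nonneg) (auto simp: dyadic_kernel_nonneg)
    then show "(c x)\<^sup>2 \<le> 4 * m\<^sup>2 * (\<Sum>y\<in>U. dyadic_kernel J x y)\<^sup>2"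
      by (simp add: c_def power_mult_distrib mult_left_mono)
  qed
  also have "\<dots> \<le> 4 * m\<^sup>2 * (2 * 2 ^ J * energy J U)"
    unfolding sum_distrib_left[symmetric]
    by (intro mult_left_mono sum_row_dyadic_kernel_square[OF U]) auto
  finally have c: "s * (\<Sum>x\<in>tile J a. (c x)\<^sup>2) \<le> s * (4 * m\<^sup>2 * (2 * 2 ^ J * energy J U))"
    using s0 by (rule mult_left_mono)
  have "(\<Sum>x\<in>tile J a. \<Sum>y\<in>tile J a - {x}. (dyadic_kernel J x y)\<^sup>2)
      \<le> (\<Sum>x\<in>tile J a. \<Sum>y\<in>tile J a. (dyadic_kernel J x y)\<^sup>2)"
    by (intro sum_mono sum_mono2) auto
  also have "\<dots> \<le> (\<Sum>x\<in>tile J a. 4 * (real J + 1))"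
    by (intro sum_mono sum_dyadic_kernel_square_le)
  also have "\<dots> = 4 * 4 ^ J * (real J + 1)" by (simp add: card_tile)
  finally have "2 * s\<^sup>2 * (\<Sum>x\<in>tile J a. \<Sum>y\<in>tile J a - {x}. (dyadic_kernel J x y)\<^sup>2)
      \<le> 2 * s\<^sup>2 * (4 * 4 ^ J * (real J + 1))"
    by (rule mult_left_mono) simp
  then show "expectation (\<lambda>t. (F t)\<^sup>2) \<le> 8 * s * m\<^sup>2 * 2 ^ J * energy J U + 8 * s\<^sup>2 * 4 ^ J * (real J + 1)"
    unfolding F using * c by (auto simp: mult_ac)
qed

text \<open>A quarter of \<open>m\<^sup>2\<close> times the energy guaranteed in a well visited
  tile. For \<open>J >= 1023\<close> the tilted mean of the form there is at least twice this
  value.\<close>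

definition threshold :: "nat \<Rightarrow> real \<Rightarrow> real" where
  "threshold J m = m\<^sup>2 * 2 ^ J * (real J + 1) / 256"

text \<open>Common Chebyshev bound for the untilted and the tilted law, where
  \<open>\<kappa>\<close> stands for \<open>s / m\<^sup>2\<close>. It tends to 0 as \<open>J\<close>
  grows.\<close>

definition deviation :: "nat \<Rightarrow> real \<Rightarrow> real" where
  "deviation J \<kappa> = 2 ^ 19 * (\<kappa> + \<kappa>\<^sup>2) / (real J + 1)"

lemma (in prob_space) prob_square_ge:
  fixes F :: "'a \<Rightarrow> real"
  assumes [measurable]: "F \<in> borel_measurable M" and int: "integrable M (\<lambda>t. (F t)\<^sup>2)" and b: "b > 0"
    and imp: "\<And>t. t \<in> space M \<Longrightarrow> P t \<Longrightarrow> b \<le> \<bar>F t\<bar>"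
  shows "prob {t \<in> space M. P t} \<le> expectation (\<lambda>t. (F t)\<^sup>2) / b\<^sup>2"
proof -
  have "prob {t \<in> space M. P t} \<le> prob {t \<in> space M. b\<^sup>2 \<le> (F t)\<^sup>2}"
  proof (rule finite_measure_mono)
    show "{t \<in> space M. P t} \<subseteq> {t \<in> space M. b\<^sup>2 \<le> (F t)\<^sup>2}"
      using imp b by (auto simp: abs_le_square_iff[symmetric])
  qed measurable
  also have "\<dots> \<le> expectation (\<lambda>t. (F t)\<^sup>2) / b\<^sup>2"
    using b by (intro integral_Markov_inequality_measure[OF int, of "{}"]) auto
  finally show ?thesis .
qed

text \<open>Chebyshev with \<open>U\<close> empty: the form is centered with variance at most of
  order \<open>4 ^ J * (J + 1)\<close>, while the squared threshold has order
  \<open>4 ^ J * (J + 1) ^ 2\<close>.\<close>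

lemma (in prob_space) prob_tile_form_ge:
  fixes X :: "int \<times> int \<Rightarrow> 'a \<Rightarrow> real"
  assumes ind: "indep_vars (\<lambda>_. borel) X UNIV" and m: "m \<noteq> 0" and s: "0 \<le> s"
    and int: "\<And>x. integrable M (\<lambda>t. (X x t)\<^sup>2)"
    and mean: "\<And>x. expectation (X x) = 0" and var: "\<And>x. variance (X x) \<le> s"
  shows "prob {t \<in> space M. threshold J m \<le> tile_form J X a t} \<le> deviation J (s / m\<^sup>2)"
proof -
  have [measurable]: "tile_form J X a \<in> borel_measurable M"
    using indep_tile_form[OF ind] unfolding indep_vars_def by blast
  have q: "quadratic_form (dyadic_kernel J) {} (\<lambda>_. 1) = 0" by (simp add: quadratic_form_def)
  note F = tile_form_second_moment[OF ind, of "{}" J a m s, OF _ int _ var, unfolded q, simplified,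
      OF mean]
  define b where "b = threshold J m"
  have b: "b > 0" using m by (simp add: b_def threshold_def)
  have "prob {t \<in> space M. b \<le> tile_form J X a t} \<le> expectation (\<lambda>t. (tile_form J X a t)\<^sup>2) / b\<^sup>2"
    by (rule prob_square_ge[OF _ F(1) b]) auto
  also have "\<dots> \<le> (8 * s\<^sup>2 * 4 ^ J * (real J + 1)) / b\<^sup>2"
    using F(2) by (intro divide_right_mono) (auto simp: energy_def)
  also have "\<dots> = 2 ^ 19 * (s / m\<^sup>2)\<^sup>2 / (real J + 1)"
  proof -
    have "((2::real) ^ J)\<^sup>2 = 4 ^ J" by (simp add: power2_eq_square power_mult_distrib[symmetric])
    then have b2: "b\<^sup>2 = (m\<^sup>2)\<^sup>2 * 4 ^ J * (real J + 1)\<^sup>2 / 65536"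
      by (simp add: b_def threshold_def power_divide power_mult_distrib)
    have alg: "(8 * s\<^sup>2 * L * n) / ((m\<^sup>2)\<^sup>2 * L * n\<^sup>2 / 65536) = 2 ^ 19 * (s / m\<^sup>2)\<^sup>2 / n"
      if "L > 0" "n > 0" for L n :: real
      using m that by (simp add: field_simps power2_eq_square)
    show ?thesis unfolding b2 by (rule alg) simp_all
  qed
  also have "\<dots> \<le> deviation J (s / m\<^sup>2)"
    unfolding deviation_def using s by (intro divide_right_mono mult_left_mono) auto
  finally show ?thesis by (simp add: b_def)
qed

lemma (in prob_space) prob_tile_form_less:
  fixes X :: "int \<times> int \<Rightarrow> 'a \<Rightarrow> real"
  assumes ind: "indep_vars (\<lambda>_. borel) X UNIV" and m: "m \<noteq> 0" and s: "0 \<le> s"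
    and U: "U \<subseteq> tile J a" and J: "1024 \<le> J + 1"
    and e: "2 ^ J * (real J + 1) / 64 \<le> energy J U"
    and int: "\<And>x. x \<in> tile J a \<Longrightarrow> integrable M (\<lambda>t. (X x t)\<^sup>2)"
    and mean: "\<And>x. x \<in> tile J a \<Longrightarrow> expectation (X x) = m * of_bool (x \<in> U)"
    and var: "\<And>x. x \<in> tile J a \<Longrightarrow> variance (X x) \<le> s"
  shows "prob {t \<in> space M. tile_form J X a t < threshold J m} \<le> deviation J (s / m\<^sup>2)"
proof -
  have [measurable]: "tile_form J X a \<in> borel_measurable M"
    using indep_tile_form[OF ind] unfolding indep_vars_def by blast
  define e where "e = energy J U"
  define D where "D = quadratic_form (dyadic_kernel J) U (\<lambda>_. 1)"
  define b where "b = m\<^sup>2 * e / 4"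
  note F = tile_form_second_moment[OF ind U int mean var, folded D_def]
  have finU: "finite U" by (rule finite_subset[OF U]) simp
  have J': "1024 \<le> real J + 1" using J by simp
  have le: "2 ^ J * (real J + 1) \<le> 64 * e" using e by (simp add: e_def)
  then have e0: "e > 0" by (smt (verit) J' mult_pos_pos zero_less_power)
  have l: "2 ^ J \<le> 64 * e / (real J + 1)" using le J' by (simp add: field_simps)
  \<comment> \<open>From \<open>1024 <= J + 1\<close> and \<open>64 / 1024 = (1/4) ^ 2\<close>, the
    number of sites is at most \<open>e / 4\<close>; the missing diagonal, at most 2 per site, thus
    costs no more than half of the energy.\<close>
  have "(real (card U))\<^sup>2 \<le> (e / 4)\<^sup>2"
  proof -
    have "(real (card U))\<^sup>2 \<le> 2 ^ J * e" unfolding e_def by (rule card_square_le_energy[OF U])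
    also have "\<dots> \<le> (64 * e / (real J + 1)) * e" using l e0 by (intro mult_right_mono) auto
    also have "\<dots> \<le> (64 * e / 1024) * e"
      using J' e0 by (intro mult_right_mono divide_left_mono) auto
    finally show ?thesis by (simp add: power2_eq_square)
  qed
  then have "real (card U) \<le> e / 4" by (rule power2_le_imp_le) (use e0 in simp)
  then have D: "e / 2 \<le> D"
    using quadratic_form_ge_energy[OF finU, of J] by (simp add: e_def D_def)
  have b: "b > 0" using m e0 by (simp add: b_def)
  have "prob {t \<in> space M. tile_form J X a t < threshold J m}
      \<le> expectation (\<lambda>t. (tile_form J X a t - m\<^sup>2 * D)\<^sup>2) / b\<^sup>2"
  proof (rule prob_square_ge[OF _ F(1) b])
    fix t assume "tile_form J X a t < threshold J m"
    also have "threshold J m \<le> m\<^sup>2 * (e / 4)"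
      unfolding threshold_def using mult_left_mono[OF le, of "m\<^sup>2"] by (simp add: algebra_simps)
    also have "\<dots> = m\<^sup>2 * (e / 2) - b" by (simp add: b_def)
    also have "m\<^sup>2 * (e / 2) \<le> m\<^sup>2 * D" using D by (rule mult_left_mono) simp
    finally show "b \<le> \<bar>tile_form J X a t - m\<^sup>2 * D\<bar>" by linarith
  qed simp
  \<comment> \<open>The energy may be much larger than its lower bound, so \<open>2 ^ J\<close> is
    traded for \<open>64 * e / (J + 1)\<close>: both variance terms then scale like
    \<open>e\<^sup>2\<close>, as \<open>b\<^sup>2\<close> does.\<close>
  also have "\<dots> \<le> (2 ^ 9 * s * m\<^sup>2 * e\<^sup>2 / (real J + 1) + 2 ^ 15 * s\<^sup>2 * e\<^sup>2 / (real J + 1)) / b\<^sup>2"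
  proof (intro divide_right_mono order_trans[OF F(2)] add_mono)
    have "8 * s * m\<^sup>2 * 2 ^ J * e \<le> 8 * s * m\<^sup>2 * (64 * e / (real J + 1)) * e"
      using l s e0 by (intro mult_right_mono mult_left_mono) auto
    then show "8 * s * m\<^sup>2 * 2 ^ J * energy J U \<le> 2 ^ 9 * s * m\<^sup>2 * e\<^sup>2 / (real J + 1)"
      by (simp add: e_def power2_eq_square mult_ac)
    have "(4::real) ^ J * (real J + 1) = 2 ^ J * (2 ^ J * (real J + 1))"
      by (simp add: power_mult_distrib[symmetric])
    also have "\<dots> \<le> (64 * e / (real J + 1)) * (64 * e)"
      by (rule mult_mono[OF l le]) (use e0 in auto)
    finally have "8 * s\<^sup>2 * (4 ^ J * (real J + 1)) \<le> 8 * s\<^sup>2 * ((64 * e / (real J + 1)) * (64 * e))"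
      by (rule mult_left_mono) simp
    then show "8 * s\<^sup>2 * 4 ^ J * (real J + 1) \<le> 2 ^ 15 * s\<^sup>2 * e\<^sup>2 / (real J + 1)"
      by (simp add: power2_eq_square mult_ac)
  qed simp_all
  also have "\<dots> = (2 ^ 13 * (s / m\<^sup>2) + 2 ^ 19 * (s / m\<^sup>2)\<^sup>2) / (real J + 1)"
    unfolding b_def using m e0 by (simp add: divide_simps power2_eq_square) (simp add: algebra_simps)
  also have "\<dots> \<le> deviation J (s / m\<^sup>2)"
  proof -
    have "0 \<le> s / m\<^sup>2" using s by simp
    then have "2 ^ 13 * (s / m\<^sup>2) \<le> 2 ^ 19 * (s / m\<^sup>2)" by (intro mult_right_mono) auto
    then show ?thesis
      unfolding deviation_def by (intro divide_right_mono) (auto simp: distrib_left)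
  qed
  finally show ?thesis .
qed

text \<open>Union bound over the subsets of size \<open>n\<close>, of which there are at most
  \<open>2 ^ card G\<close>; on each of them independence gives \<open>p ^ n\<close>.\<close>

lemma (in prob_space) prob_many_indep_le:
  assumes ind: "indep_vars (\<lambda>_. borel) Q UNIV" and B: "B \<in> sets borel" and G: "finite G" and p0: "0 \<le> p"
    and p: "\<And>a. a \<in> G \<Longrightarrow> prob {t \<in> space M. Q a t \<in> B} \<le> p"
  shows "prob {t \<in> space M. n \<le> card {a \<in> G. Q a t \<in> B}} \<le> 2 ^ card G * p ^ n"
proof -
  have [measurable]: "Q a \<in> borel_measurable M" for a using ind unfolding indep_vars_def by blast
  note [measurable] = B
  let ?E = "\<lambda>A. {t \<in> space M. \<forall>a\<in>A. Q a t \<in> B}"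
  have all: "prob (?E A) \<le> p ^ card A" if A: "A \<subseteq> G" for A
  proof (cases "A = {}")
    case True
    then show ?thesis by (simp add: prob_space)
  next
    case False
    have finA: "finite A" using A G finite_subset by auto
    have "?E A = (\<Inter>a\<in>A. Q a -` B \<inter> space M)" using False by auto
    then have "prob (?E A) = (\<Prod>a\<in>A. prob (Q a -` B \<inter> space M))"
      using indep_varsD[OF ind False finA, of "\<lambda>_. B"] B by simp
    also have "\<dots> \<le> (\<Prod>a\<in>A. p)"
    proof (intro prod_mono conjI)
      fix a assume a: "a \<in> A"
      have "Q a -` B \<inter> space M = {t \<in> space M. Q a t \<in> B}" by auto
      then show "prob (Q a -` B \<inter> space M) \<le> p" using p a A by auto
    qed simp
    finally show ?thesis by simp
  qed
  let ?AA = "{A. A \<subseteq> G \<and> card A = n}"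
  have fin: "finite ?AA" using G by simp
  have "prob {t \<in> space M. n \<le> card {a \<in> G. Q a t \<in> B}} \<le> prob (\<Union>A\<in>?AA. ?E A)"
  proof (rule finite_measure_mono)
    show "{t \<in> space M. n \<le> card {a \<in> G. Q a t \<in> B}} \<subseteq> (\<Union>A\<in>?AA. ?E A)"
    proof safe
      fix t assume t: "t \<in> space M" "n \<le> card {a \<in> G. Q a t \<in> B}"
      obtain A where "A \<subseteq> {a \<in> G. Q a t \<in> B}" "card A = n"
        using obtain_subset_with_card_n[OF t(2)] by blast
      then show "t \<in> (\<Union>A\<in>?AA. ?E A)" using t(1) by (intro UN_I[of A]) auto
    qed
    have "finite A" if "A \<subseteq> G" for A using that G finite_subset by auto
    then show "(\<Union>A\<in>?AA. ?E A) \<in> events" using fin by (intro sets.finite_UN) auto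
  qed
  also have "\<dots> \<le> (\<Sum>A\<in>?AA. prob (?E A))"
  proof (rule finite_measure_subadditive_finite[OF fin])
    have "finite A" if "A \<subseteq> G" for A using that G finite_subset by auto
    then show "?E ` ?AA \<subseteq> events" by auto
  qed
  also have "\<dots> \<le> (\<Sum>A\<in>?AA. p ^ n)" using all by (intro sum_mono) auto
  also have "\<dots> = real (card ?AA) * p ^ n" by simp
  also have "\<dots> \<le> 2 ^ card G * p ^ n"
  proof (intro mult_right_mono zero_le_power p0)
    have "card ?AA \<le> card (Pow G)" using G by (intro card_mono) auto
    then have "card ?AA \<le> 2 ^ card G" using G by (simp add: card_Pow)
    then show "real (card ?AA) \<le> 2 ^ card G"
      by (metis of_nat_le_iff of_nat_numeral of_nat_power)
  qed
  finally show ?thesis .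
qed

section \<open>The tilted environment\<close>

lemma square_le_exp: "(x::real)\<^sup>2 \<le> 2 * (exp x + exp (- x))"
proof -
  have "\<bar>x\<bar>\<^sup>2 \<le> 2 * exp \<bar>x\<bar>"
    using exp_lower_Taylor_quadratic[of "\<bar>x\<bar>"] by simp
  also have "exp \<bar>x\<bar> \<le> exp x + exp (- x)" by (cases "0 \<le> x") auto
  finally show ?thesis by simp
qed

locale random_environment = prob_space M for M :: "'a measure" +
  fixes \<omega> :: "int \<times> int \<Rightarrow> 'a \<Rightarrow> real" and \<beta> :: real
  assumes indep: "indep_vars (\<lambda>_. borel) \<omega> UNIV"
    and ident: "\<And>x. distr M borel (\<omega> x) = distr M borel (\<omega> 0)"
    and mean: "expectation (\<omega> 0) = 0"
    and var: "variance (\<omega> 0) = 1"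
    and exp_moments: "\<And>b::real. integrable M (\<lambda>t. exp (b * \<omega> 0 t))"
    and beta: "\<beta> \<noteq> 0"
begin

lemma omega_meas [measurable]: "\<omega> x \<in> borel_measurable M"
  using indep unfolding indep_vars_def by blast

lemma integrable_omega_iff:
  assumes [measurable]: "g \<in> borel_measurable borel"
  shows "integrable M (\<lambda>t. g (\<omega> x t)) \<longleftrightarrow> integrable M (\<lambda>t. g (\<omega> 0 t) :: real)"
proof -
  have "integrable M (\<lambda>t. g (\<omega> y t)) \<longleftrightarrow> integrable (distr M borel (\<omega> y)) g" for y
    by (rule integrable_distr_eq[symmetric]) auto
  then show ?thesis by (simp add: ident[of x])
qed

lemma expectation_omega:
  assumes [measurable]: "g \<in> borel_measurable borel"
  shows "expectation (\<lambda>t. g (\<omega> x t)) = (expectation (\<lambda>t. g (\<omega> 0 t)) :: real)"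
proof -
  have "expectation (\<lambda>t. g (\<omega> y t)) = integral\<^sup>L (distr M borel (\<omega> y)) g" for y
    by (rule integral_distr[symmetric]) auto
  then show ?thesis by (simp add: ident[of x])
qed

text \<open>The polynomial factor is absorbed by exponentials with parameters \<open>b + 1\<close>
  and \<open>b - 1\<close>.\<close>

lemma integrable_square_exp: "integrable M (\<lambda>t. (\<omega> 0 t)\<^sup>2 * exp (b * \<omega> 0 t))"
proof (rule Bochner_Integration.integrable_bound)
  show "integrable M (\<lambda>t. 2 * (exp ((b + 1) * \<omega> 0 t) + exp ((b - 1) * \<omega> 0 t)))"
    using exp_moments by (intro integrable_mult_right Bochner_Integration.integrable_add)
  have "(\<omega> 0 t)\<^sup>2 * exp (b * \<omega> 0 t) \<le> 2 * (exp ((b + 1) * \<omega> 0 t) + exp ((b - 1) * \<omega> 0 t))" for t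
  proof -
    have "(\<omega> 0 t)\<^sup>2 * exp (b * \<omega> 0 t) \<le> 2 * (exp (\<omega> 0 t) + exp (- \<omega> 0 t)) * exp (b * \<omega> 0 t)"
      by (intro mult_right_mono square_le_exp) simp
    then show ?thesis by (simp add: distrib_right left_diff_distrib exp_add[symmetric] algebra_simps)
  qed
  then show "AE t in M. norm ((\<omega> 0 t)\<^sup>2 * exp (b * \<omega> 0 t))
      \<le> norm (2 * (exp ((b + 1) * \<omega> 0 t) + exp ((b - 1) * \<omega> 0 t)))"
    by (simp add: abs_mult)
qed simp

lemma integrable_square: "integrable M (\<lambda>t. (\<omega> x t)\<^sup>2)"
  using integrable_square_exp[of 0] integrable_omega_iff[of "\<lambda>y. y\<^sup>2" x] by simp

lemma integrable_omega: "integrable M (\<omega> x)"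
  by (rule square_integrable_imp_integrable[OF _ integrable_square]) simp

lemma integrable_omega_exp: "integrable M (\<lambda>t. \<omega> 0 t * exp (b * \<omega> 0 t))"
proof (rule Bochner_Integration.integrable_bound)
  show "integrable M (\<lambda>t. (\<omega> 0 t)\<^sup>2 * exp (b * \<omega> 0 t) + exp (b * \<omega> 0 t))"
    using exp_moments integrable_square_exp by (intro Bochner_Integration.integrable_add)
  have "\<bar>y\<bar> \<le> y\<^sup>2 + 1" for y :: real
    using sum_squares_bound[of "\<bar>y\<bar>" 1] by simp
  then have "\<bar>\<omega> 0 t\<bar> * exp (b * \<omega> 0 t) \<le> ((\<omega> 0 t)\<^sup>2 + 1) * exp (b * \<omega> 0 t)" for t
    by (intro mult_right_mono) auto
  then show "AE t in M. norm (\<omega> 0 t * exp (b * \<omega> 0 t))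
      \<le> norm ((\<omega> 0 t)\<^sup>2 * exp (b * \<omega> 0 t) + exp (b * \<omega> 0 t))"
    by (simp add: abs_mult distrib_right abs_of_nonneg)
qed simp

definition mgf :: real where "mgf = expectation (\<lambda>t. exp (\<beta> * \<omega> 0 t))"

definition tilted_mean :: real where
  "tilted_mean = expectation (\<lambda>t. \<omega> 0 t * exp (\<beta> * \<omega> 0 t)) / mgf"

text \<open>The maximum covers both kinds of sites: variance 1 off the tilted set, and on it the
  tilted second moment, which dominates the variance.\<close>

definition variance_bound :: real where
  "variance_bound = max 1 (expectation (\<lambda>t. (\<omega> 0 t)\<^sup>2 * exp (\<beta> * \<omega> 0 t)) / mgf)"

text \<open>From \<open>exp y >= 1 + y\<close>, the linear term having mean zero.\<close>

lemma mgf_ge_1: "1 \<le> mgf"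
proof -
  have "expectation (\<lambda>t. 1 + \<beta> * \<omega> 0 t) \<le> mgf"
    unfolding mgf_def using integrable_omega exp_moments
    by (intro integral_mono) (auto intro: exp_ge_add_one_self)
  then show ?thesis using integrable_omega[of 0] mean by (simp add: prob_space)
qed

lemma expectation_square: "expectation (\<lambda>t. (\<omega> x t)\<^sup>2) = 1"
  using var mean expectation_omega[of "\<lambda>y. y\<^sup>2" x] by simp

lemma expectation_omega_0: "expectation (\<omega> x) = 0"
  using mean expectation_omega[of "\<lambda>y. y" x] by simp

text \<open>Since \<open>\<omega>\<close> is centered, \<open>\<beta>\<close> times the tilted mean is, up to the factor \<open>mgf\<close>, the
  expectation of the nonnegative variable \<open>\<beta> * \<omega> * (exp (\<beta> * \<omega>) - 1)\<close>.\<close>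

lemma tilted_mean_nonzero: "tilted_mean \<noteq> 0"
proof
  assume "tilted_mean = 0"
  then have 0: "expectation (\<lambda>t. \<omega> 0 t * exp (\<beta> * \<omega> 0 t)) = 0"
    using mgf_ge_1 by (simp add: tilted_mean_def)
  let ?f = "\<lambda>t. \<beta> * \<omega> 0 t * (exp (\<beta> * \<omega> 0 t) - 1)"
  have f: "?f t = \<beta> * (\<omega> 0 t * exp (\<beta> * \<omega> 0 t)) - \<beta> * \<omega> 0 t" for t
    by (simp add: algebra_simps)
  have int: "integrable M ?f"
    unfolding f using integrable_omega_exp integrable_omega by auto
  have "expectation ?f = 0"
    unfolding f using integrable_omega_exp integrable_omega 0 mean by simp
  moreover have pos: "0 \<le> y * (exp y - 1)" for y :: real
    by (cases "0 \<le> y") (auto intro: mult_nonpos_nonpos)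
  ultimately have "AE t in M. ?f t = 0"
    using integral_nonneg_eq_0_iff_AE[OF int] by simp
  then have "AE t in M. (\<omega> 0 t)\<^sup>2 = 0" using beta by auto
  then have "expectation (\<lambda>t. (\<omega> 0 t)\<^sup>2) = expectation (\<lambda>t. 0)"
    by (intro integral_cong_AE) auto
  then show False using expectation_square[of 0] by simp
qed

definition weight :: "real \<Rightarrow> ennreal" where "weight y = ennreal (exp (\<beta> * y) / mgf)"

lemma tilted_field: "finite F \<Longrightarrow> tilted_field M \<omega> F weight"
proof
  show "indep_vars (\<lambda>_. borel) \<omega> UNIV" by (rule indep)
  show "weight \<in> borel_measurable borel" unfolding weight_def by measurable
  show "(\<integral>\<^sup>+t. weight (\<omega> x t) \<partial>M) = 1" for x
  proof -
    have "integrable M (\<lambda>t. exp (\<beta> * \<omega> x t) / mgf)"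
      using exp_moments integrable_omega_iff[of "\<lambda>y. exp (\<beta> * y)" x] by simp
    then have "(\<integral>\<^sup>+t. weight (\<omega> x t) \<partial>M) = ennreal (expectation (\<lambda>t. exp (\<beta> * \<omega> x t) / mgf))"
      unfolding weight_def using mgf_ge_1 by (intro nn_integral_eq_integral) auto
    also have "expectation (\<lambda>t. exp (\<beta> * \<omega> x t) / mgf) = 1"
      using expectation_omega[of "\<lambda>y. exp (\<beta> * y)" x] mgf_ge_1 by (simp add: mgf_def)
    finally show ?thesis by simp
  qed
qed

section \<open>The field under the tilted law\<close>

definition tilted :: "(int \<times> int) set \<Rightarrow> 'a measure" where
  "tilted F = tilted_field.tilt M \<omega> F weight"

lemma prob_space_tilted: "finite F \<Longrightarrow> prob_space (tilted F)"
  unfolding tilted_def by (rule tilted_field.prob_space_tilt[OF tilted_field])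

lemma indep_tilted: "finite F \<Longrightarrow> prob_space.indep_vars (tilted F) (\<lambda>_. borel) \<omega> UNIV"
  unfolding tilted_def by (rule tilted_field.indep_tilt[OF tilted_field])

lemma tilted_in:
  assumes F: "finite F" and x: "x \<in> F" and [measurable]: "g \<in> borel_measurable borel"
    and int: "integrable M (\<lambda>t. g (\<omega> 0 t) * exp (\<beta> * \<omega> 0 t))"
  shows "integrable (tilted F) (\<lambda>t. g (\<omega> x t) :: real)"
    and "(\<integral>t. g (\<omega> x t) \<partial>tilted F) = expectation (\<lambda>t. g (\<omega> 0 t) * exp (\<beta> * \<omega> 0 t)) / mgf"
proof -
  interpret T: tilted_field M \<omega> F weight by (rule tilted_field[OF F])
  have d: "distr (tilted F) borel (\<omega> x) = density (distr M borel (\<omega> 0)) (\<lambda>y. ennreal (exp (\<beta> * y) / mgf))"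
    unfolding tilted_def T.distr_tilt_in[OF x] ident[of x] by (simp add: weight_def[abs_def])
  have [measurable]: "\<omega> x \<in> measurable (tilted F) borel"
    unfolding tilted_def by measurable
  have pos: "0 \<le> exp (\<beta> * y) / mgf" for y using mgf_ge_1 by simp
  have "integrable (tilted F) (\<lambda>t. g (\<omega> x t)) \<longleftrightarrow> integrable (distr (tilted F) borel (\<omega> x)) g"
    by (rule integrable_distr_eq[symmetric]) auto
  also have "\<dots> \<longleftrightarrow> integrable (distr M borel (\<omega> 0)) (\<lambda>y. (exp (\<beta> * y) / mgf) *\<^sub>R g y)"
    unfolding d by (rule integrable_density) (use pos in auto)
  also have "\<dots> \<longleftrightarrow> integrable M (\<lambda>t. (exp (\<beta> * \<omega> 0 t) / mgf) *\<^sub>R g (\<omega> 0 t))"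
    by (rule integrable_distr_eq) auto
  finally show "integrable (tilted F) (\<lambda>t. g (\<omega> x t))"
    using int by (simp add: mult.commute)
  have "(\<integral>t. g (\<omega> x t) \<partial>tilted F) = integral\<^sup>L (distr (tilted F) borel (\<omega> x)) g"
    by (rule integral_distr[symmetric]) auto
  also have "\<dots> = integral\<^sup>L (distr M borel (\<omega> 0)) (\<lambda>y. (exp (\<beta> * y) / mgf) *\<^sub>R g y)"
    unfolding d by (rule integral_density) (use pos in auto)
  also have "\<dots> = expectation (\<lambda>t. (exp (\<beta> * \<omega> 0 t) / mgf) *\<^sub>R g (\<omega> 0 t))"
    by (rule integral_distr) auto
  finally show "(\<integral>t. g (\<omega> x t) \<partial>tilted F) = expectation (\<lambda>t. g (\<omega> 0 t) * exp (\<beta> * \<omega> 0 t)) / mgf"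
    by (simp add: mult.commute)
qed

lemma tilted_notin:
  assumes F: "finite F" and x: "x \<notin> F" and [measurable]: "g \<in> borel_measurable borel"
  shows "integrable (tilted F) (\<lambda>t. g (\<omega> x t) :: real) \<longleftrightarrow> integrable M (\<lambda>t. g (\<omega> x t))"
    and "(\<integral>t. g (\<omega> x t) \<partial>tilted F) = expectation (\<lambda>t. g (\<omega> x t))"
proof -
  interpret T: tilted_field M \<omega> F weight by (rule tilted_field[OF F])
  have d: "distr (tilted F) borel (\<omega> x) = distr M borel (\<omega> x)"
    unfolding tilted_def by (rule T.distr_tilt_notin[OF x])
  have [measurable]: "\<omega> x \<in> measurable (tilted F) borel"
    unfolding tilted_def by measurable
  show "integrable (tilted F) (\<lambda>t. g (\<omega> x t)) \<longleftrightarrow> integrable M (\<lambda>t. g (\<omega> x t))"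
    using integrable_distr_eq[of "\<omega> x" "tilted F" borel g] integrable_distr_eq[of "\<omega> x" M borel g] d
    by simp
  show "(\<integral>t. g (\<omega> x t) \<partial>tilted F) = expectation (\<lambda>t. g (\<omega> x t))"
    using integral_distr[of "\<omega> x" "tilted F" borel g] integral_distr[of "\<omega> x" M borel g] d
    by simp
qed

lemma tilted_moments:
  assumes F: "finite F"
  shows "integrable (tilted F) (\<lambda>t. (\<omega> x t)\<^sup>2)"
    and "(\<integral>t. \<omega> x t \<partial>tilted F) = tilted_mean * of_bool (x \<in> F)"
    and "(\<integral>t. (\<omega> x t)\<^sup>2 \<partial>tilted F) \<le> variance_bound"
proof -
  show "integrable (tilted F) (\<lambda>t. (\<omega> x t)\<^sup>2)"
    using tilted_in(1)[OF F, of x "\<lambda>y. y\<^sup>2"] tilted_notin(1)[OF F, of x "\<lambda>y. y\<^sup>2"]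
      integrable_square_exp integrable_square by (cases "x \<in> F") auto
  show "(\<integral>t. \<omega> x t \<partial>tilted F) = tilted_mean * of_bool (x \<in> F)"
    using tilted_in(2)[OF F, of x "\<lambda>y. y"] tilted_notin(2)[OF F, of x "\<lambda>y. y"]
      integrable_omega_exp expectation_omega_0 by (cases "x \<in> F") (auto simp: tilted_mean_def)
  show "(\<integral>t. (\<omega> x t)\<^sup>2 \<partial>tilted F) \<le> variance_bound"
    using tilted_in(2)[OF F, of x "\<lambda>y. y\<^sup>2"] tilted_notin(2)[OF F, of x "\<lambda>y. y\<^sup>2"]
      integrable_square_exp expectation_square by (cases "x \<in> F") (auto simp: variance_bound_def)
qed

lemma tilted_variance:
  assumes F: "finite F"
  shows "(\<integral>t. (\<omega> x t - (\<integral>t. \<omega> x t \<partial>tilted F))\<^sup>2 \<partial>tilted F) \<le> variance_bound"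
proof -
  interpret T: prob_space "tilted F" by (rule prob_space_tilted[OF F])
  have [measurable]: "\<omega> x \<in> borel_measurable (tilted F)"
    using indep_tilted[OF F] unfolding T.indep_vars_def by blast
  have "T.variance (\<omega> x) = T.expectation (\<lambda>t. (\<omega> x t)\<^sup>2) - (T.expectation (\<omega> x))\<^sup>2"
    using tilted_moments(1)[OF F] T.square_integrable_imp_integrable[of "\<omega> x"]
    by (intro T.variance_eq) auto
  also have "\<dots> \<le> T.expectation (\<lambda>t. (\<omega> x t)\<^sup>2)" by simp
  finally show ?thesis using tilted_moments(3)[OF F, of x] by simp
qed

lemma tilted_space: "space (tilted F) = space M" "sets (tilted F) = sets M" if "finite F"
  unfolding tilted_def
  by (simp_all add: tilted_field.space_tilt[OF tilted_field[OF that]]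
      tilted_field.sets_tilt[OF tilted_field[OF that]])

section \<open>Path weights as tilted probabilities\<close>

abbreviation path_weight :: "(nat \<Rightarrow> int \<times> int) \<Rightarrow> nat \<Rightarrow> 'a \<Rightarrow> real" where
  "path_weight S N t \<equiv> exp (\<beta> * (\<Sum>n=0..N. \<omega> (S n) t))"

text \<open>Since a self-avoiding path meets \<open>N + 1\<close> distinct sites, its weight is
  \<open>mgf ^ Suc N\<close> times the density of the law tilted on these sites.\<close>

lemma path_weight_tilted:
  assumes S: "S \<in> saws N" and [measurable]: "T \<in> sets M"
  shows "integrable M (\<lambda>t. path_weight S N t * indicator T t)"
    and "expectation (\<lambda>t. path_weight S N t * indicator T t)
      = mgf ^ Suc N * measure (tilted (S ` {0..N})) T"
proof -
  let ?F = "S ` {0..N}"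
  have inj: "inj_on S {0..N}" using S by (simp add: saws_def)
  interpret T: tilted_field M \<omega> ?F weight by (rule tilted_field) simp
  interpret P: prob_space "tilted ?F" by (rule prob_space_tilted) simp
  have L: "mgf > 0" using mgf_ge_1 by simp
  have w: "(\<Prod>x\<in>?F. weight (\<omega> x t)) = ennreal (path_weight S N t / mgf ^ Suc N)" for t
  proof -
    have "(\<Prod>x\<in>?F. weight (\<omega> x t)) = (\<Prod>n=0..N. ennreal (exp (\<beta> * \<omega> (S n) t) / mgf))"
      by (simp add: prod.reindex[OF inj] weight_def)
    also have "\<dots> = ennreal (\<Prod>n=0..N. exp (\<beta> * \<omega> (S n) t) / mgf)"
      using L by (intro prod_ennreal) simp
    also have "(\<Prod>n=0..N. exp (\<beta> * \<omega> (S n) t) / mgf) = path_weight S N t / mgf ^ Suc N"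
      by (simp add: prod_dividef exp_sum[symmetric] sum_distrib_left)
    finally show ?thesis .
  qed
  have "emeasure (tilted ?F) T
      = (\<integral>\<^sup>+t. ennreal (path_weight S N t / mgf ^ Suc N) * indicator T t \<partial>M)"
    unfolding tilted_def T.tilt_def w by (rule emeasure_density) auto
  then have "ennreal (mgf ^ Suc N) * emeasure (tilted ?F) T
      = (\<integral>\<^sup>+t. ennreal (mgf ^ Suc N) * (ennreal (path_weight S N t / mgf ^ Suc N) * indicator T t) \<partial>M)"
    by (simp add: nn_integral_cmult)
  also have "\<dots> = (\<integral>\<^sup>+t. ennreal (path_weight S N t * indicator T t) \<partial>M)"
    using L by (intro nn_integral_cong)
      (auto simp: indicator_def ennreal_mult[symmetric] simp del: power_Suc)
  finally have "(\<integral>\<^sup>+t. ennreal (path_weight S N t * indicator T t) \<partial>M)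
      = ennreal (mgf ^ Suc N * measure (tilted ?F) T)"
    using L P.emeasure_eq_measure
    by (simp add: ennreal_mult del: power_Suc)
  moreover have "0 \<le> mgf ^ Suc N * measure (tilted ?F) T" using L by simp
  ultimately have "integrable M (\<lambda>t. path_weight S N t * indicator T t) \<and>
      expectation (\<lambda>t. path_weight S N t * indicator T t) = mgf ^ Suc N * measure (tilted ?F) T"
    by (subst nn_integral_eq_integrable[symmetric]) auto
  then show "integrable M (\<lambda>t. path_weight S N t * indicator T t)"
    and "expectation (\<lambda>t. path_weight S N t * indicator T t)
      = mgf ^ Suc N * measure (tilted ?F) T" by auto
qed

lemma expectation_partition_fun:
  "expectation (\<lambda>t. partition_fun \<beta> (\<lambda>x. \<omega> x t) N) = real (card (saws N)) * mgf ^ Suc N"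
proof -
  have *: "integrable M (path_weight S N)" "expectation (path_weight S N) = mgf ^ Suc N"
    if "S \<in> saws N" for S
  proof -
    have e: "path_weight S N t = path_weight S N t * indicator (space M) t" if "t \<in> space M" for t
      using that by simp
    have "measure (tilted (S ` {0..N})) (space M) = 1"
      using prob_space.prob_space[OF prob_space_tilted[of "S ` {0..N}"]]
      by (simp add: tilted_space)
    then show "integrable M (path_weight S N)" "expectation (path_weight S N) = mgf ^ Suc N"
      using path_weight_tilted[OF that sets.top]
      by (simp_all cong: Bochner_Integration.integrable_cong Bochner_Integration.integral_cong)
  qed
  show ?thesis
    unfolding partition_fun_def using * by (simp add: Bochner_Integration.integral_sum)
qed

end

section \<open>Truncation of the partition function\<close>

context random_environment
begin

text \<open>There are at most \<open>81 ^ k\<close> animals of \<open>k\<close> tiles, with \<open>2 ^ k\<close> subsets each; if a subset of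
  size more than \<open>k / 18\<close> has probability at most \<open>324 powr - k\<close>, a factor \<open>2 powr - k\<close> remains.\<close>

definition rare :: real where "rare = (1 / 324) ^ 18"

definition scale :: nat where
  "scale = (SOME J. 1024 \<le> J + 1 \<and> deviation J (variance_bound / tilted_mean\<^sup>2) \<le> rare)"

lemma scale: "1024 \<le> scale + 1" "deviation scale (variance_bound / tilted_mean\<^sup>2) \<le> rare"
proof -
  define c where "c = 2 ^ 19 * (variance_bound / tilted_mean\<^sup>2 + (variance_bound / tilted_mean\<^sup>2)\<^sup>2)"
  obtain n :: nat where n: "c / rare < real n" using reals_Archimedean2 by blast
  have r: "rare > 0" by (simp add: rare_def)
  have "c / rare < real (n + 1024) + 1" using n by simp
  then have "deviation (n + 1024) (variance_bound / tilted_mean\<^sup>2) \<le> rare"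
    unfolding deviation_def c_def[symmetric] using r by (simp add: field_simps)
  then have "1024 \<le> (n + 1024) + 1 \<and> deviation (n + 1024) (variance_bound / tilted_mean\<^sup>2) \<le> rare"
    by simp
  from someI[of "\<lambda>J. 1024 \<le> J + 1 \<and> deviation J (variance_bound / tilted_mean\<^sup>2) \<le> rare", OF this]
  show "1024 \<le> scale + 1" "deviation scale (variance_bound / tilted_mean\<^sup>2) \<le> rare"
    unfolding scale_def by blast+
qed

abbreviation Q :: "int \<times> int \<Rightarrow> 'a \<Rightarrow> real" where "Q \<equiv> tile_form scale \<omega>"
abbreviation r :: real where "r \<equiv> threshold scale tilted_mean"

lemma Q_meas [measurable]: "Q a \<in> borel_measurable M"
  using indep_tile_form[OF indep] unfolding indep_vars_def by blast

lemma variance_bound_ge_1: "1 \<le> variance_bound"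
  by (simp add: variance_bound_def)

lemma rare_nonneg: "0 \<le> rare"
  by (simp add: rare_def)

lemma prob_high: "prob {t \<in> space M. Q a t \<in> {r..}} \<le> rare"
proof -
  have "variance (\<omega> x) \<le> variance_bound" for x
    using variance_bound_ge_1 by (simp add: expectation_omega_0 expectation_square)
  then have "prob {t \<in> space M. r \<le> Q a t} \<le> deviation scale (variance_bound / tilted_mean\<^sup>2)"
    using variance_bound_ge_1
    by (intro prob_tile_form_ge[OF indep tilted_mean_nonzero _ integrable_square expectation_omega_0])
       auto
  then show ?thesis using scale(2) by simp
qed

lemma prob_low:
  assumes S: "S \<in> saws N" and q: "q * 2 ^ scale \<le> N + 1" and a: "a \<in> well_visited scale S q"
  shows "measure (tilted (S ` {0..N})) {t \<in> space M. Q a t \<in> {..<r}} \<le> rare"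
proof -
  let ?F = "S ` {0..N}"
  have F: "finite ?F" by simp
  interpret P: prob_space "tilted ?F" by (rule prob_space_tilted[OF F])
  have "P.prob {t \<in> space (tilted ?F). Q a t < r} \<le> deviation scale (variance_bound / tilted_mean\<^sup>2)"
  proof (rule P.prob_tile_form_less[OF indep_tilted[OF F] tilted_mean_nonzero _ _ scale(1)])
    show "0 \<le> variance_bound" using variance_bound_ge_1 by simp
    show "?F \<inter> tile scale a \<subseteq> tile scale a" by simp
    show "2 ^ scale * (real scale + 1) / 64 \<le> energy scale (?F \<inter> tile scale a)"
      by (rule well_visited_energy[OF S q a])
    fix x assume x: "x \<in> tile scale a"
    show "integrable (tilted ?F) (\<lambda>t. (\<omega> x t)\<^sup>2)" by (rule tilted_moments(1)[OF F])
    show "P.expectation (\<omega> x) = tilted_mean * of_bool (x \<in> ?F \<inter> tile scale a)"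
      using tilted_moments(2)[OF F, of x] x by simp
    show "P.variance (\<omega> x) \<le> variance_bound" by (rule tilted_variance[OF F])
  qed
  then show ?thesis using scale(2) by (simp add: tilted_space)
qed

text \<open>Walks of \<open>2 * (k - 1)\<close> steps with \<open>k\<close> distinct tiles stand in
  for connected sets of \<open>k\<close> tiles containing the origin; \<open>Suc (k div 18)\<close>
  is the least integer above \<open>k / 18\<close>.\<close>

definition bad :: "nat \<Rightarrow> 'a set" where
  "bad k = {t \<in> space M. \<exists>xs\<in>walks 0 (2 * (k - 1)).
     card (set xs) = k \<and> Suc (k div 18) \<le> card {a \<in> set xs. Q a t \<in> {r..}}}"

lemma rare_power: "k \<le> 18 * n \<Longrightarrow> rare ^ n \<le> (1 / 324) ^ k"
  unfolding rare_def power_mult[symmetric] by (rule power_decreasing) auto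

lemma measurable_card_less [measurable]:
  assumes "finite G" and [measurable]: "B \<in> sets borel"
  shows "{t \<in> space M. n \<le> card {a \<in> G. Q a t \<in> B}} \<in> sets M"
proof -
  have "{t \<in> space M. n \<le> card {a \<in> G. Q a t \<in> B}}
      = (\<Union>A\<in>{A. A \<subseteq> G \<and> card A = n}. {t \<in> space M. \<forall>a\<in>A. Q a t \<in> B})"
  proof safe
    fix t assume t: "t \<in> space M" "n \<le> card {a \<in> G. Q a t \<in> B}"
    obtain A where "A \<subseteq> {a \<in> G. Q a t \<in> B}" "card A = n"
      using obtain_subset_with_card_n[OF t(2)] by blast
    then show "t \<in> (\<Union>A\<in>{A. A \<subseteq> G \<and> card A = n}. {t \<in> space M. \<forall>a\<in>A. Q a t \<in> B})"
      using t(1) by (intro UN_I[of A]) auto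
  next
    fix A t assume A: "A \<subseteq> G" "\<forall>a\<in>A. Q a t \<in> B"
    have "A \<subseteq> {a \<in> G. Q a t \<in> B}" using A by auto
    then show "card A \<le> card {a \<in> G. Q a t \<in> B}" using assms(1) by (intro card_mono) auto
  qed
  also have "\<dots> \<in> sets M"
  proof (intro sets.finite_UN)
    show "finite {A. A \<subseteq> G \<and> card A = n}" using assms(1) by simp
    fix A assume "A \<in> {A. A \<subseteq> G \<and> card A = n}"
    then have "finite A" using assms(1) finite_subset by auto
    then show "{t \<in> space M. \<forall>a\<in>A. Q a t \<in> B} \<in> sets M" by measurable
  qed
  finally show ?thesis .
qed

lemma bad_eq: "bad k = (\<Union>xs\<in>{xs\<in>walks 0 (2 * (k - 1)). card (set xs) = k}.
    {t \<in> space M. Suc (k div 18) \<le> card {a \<in> set xs. Q a t \<in> {r..}}})"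
  by (auto simp: bad_def)

lemma bad_sets [measurable]: "bad k \<in> sets M"
  unfolding bad_eq using finite_card_walks by (intro sets.finite_UN measurable_card_less) auto

lemma prob_bad: "prob (bad k) \<le> (1 / 2) ^ k"
proof -
  let ?W = "{xs\<in>walks 0 (2 * (k - 1)). card (set xs) = k}"
  have fin: "finite ?W" using finite_card_walks by auto
  have "card ?W \<le> card (walks 0 (2 * (k - 1)))"
    using finite_card_walks by (intro card_mono) auto
  also have "\<dots> \<le> 9 ^ (2 * (k - 1))" using finite_card_walks by blast
  also have "\<dots> \<le> 9 ^ (2 * k)" by (intro power_increasing) auto
  also have "(9::nat) ^ (2 * k) = 81 ^ k" by (simp add: power_mult)
  finally have W: "real (card ?W) \<le> 81 ^ k"
    using of_nat_mono[where 'a = real] by fastforce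
  have "prob (bad k) \<le> (\<Sum>xs\<in>?W. prob {t \<in> space M. Suc (k div 18) \<le> card {a \<in> set xs. Q a t \<in> {r..}}})"
    unfolding bad_eq
    by (intro finite_measure_subadditive_finite fin image_subsetI measurable_card_less) simp_all
  also have "\<dots> \<le> (\<Sum>xs\<in>?W. 2 ^ k * rare ^ Suc (k div 18))"
  proof (intro sum_mono)
    fix xs assume "xs \<in> ?W"
    then have "k = card (set xs)" by simp
    then show "prob {t \<in> space M. Suc (k div 18) \<le> card {a \<in> set xs. Q a t \<in> {r..}}}
        \<le> 2 ^ k * rare ^ Suc (k div 18)"
      using prob_many_indep_le[OF indep_tile_form[OF indep, of scale], of "{r..}" "set xs" rare "Suc (k div 18)"]
        prob_high rare_nonneg by simp
  qed
  also have "\<dots> = real (card ?W) * (2 ^ k * rare ^ Suc (k div 18))" by simp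
  also have "\<dots> \<le> 81 ^ k * (2 ^ k * (1 / 324) ^ k)"
    using W rare_power[of k "Suc (k div 18)"] rare_nonneg
    by (intro mult_mono mult_left_mono) auto
  also have "\<dots> = (1 / 2) ^ k"
    by (simp add: power_mult_distrib[symmetric])
  finally show ?thesis .
qed

section \<open>Typical environments along a path\<close>

definition blocks :: "nat \<Rightarrow> nat" where "blocks N = (N + 1) div 2 ^ scale"

abbreviation "V S N \<equiv> visited scale S (blocks N)"
abbreviation "G S N \<equiv> well_visited scale S (blocks N)"

lemma blocks_le: "blocks N * 2 ^ scale \<le> N + 1"
  by (simp add: blocks_def)

text \<open>Equivalently, at most \<open>card (V S N) div 18\<close> well visited tiles have large
  \<open>Q\<close>. Counting the tiles with small \<open>Q\<close> suits the tilted law, under which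
  these are the rare ones.\<close>

definition typical :: "(nat \<Rightarrow> int \<times> int) \<Rightarrow> nat \<Rightarrow> 'a set" where
  "typical S N = {t \<in> space M.
     card (G S N) - card (V S N) div 18 \<le> card {a \<in> G S N. Q a t \<in> {..<r}}}"

lemma finite_G: "finite (G S N)"
  by (rule finite_subset[OF well_visited_subset]) simp

lemma typical_sets [measurable]: "typical S N \<in> sets M"
  unfolding typical_def by (intro measurable_card_less finite_G) simp

text \<open>The well visited tiles number at least a ninth of the visited ones, and the event allows
  only an eighteenth to have large \<open>Q\<close>, so at least an eighteenth are well visited with
  small \<open>Q\<close>. The choice of \<open>rare\<close> beats the number of subsets.\<close>

lemma typical_tilted:
  assumes S: "S \<in> saws N"
  shows "measure (tilted (S ` {0..N})) (typical S N) \<le> (1 / 2) ^ card (V S N)"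
proof -
  let ?F = "S ` {0..N}" and ?n = "card (G S N) - card (V S N) div 18"
  interpret P: prob_space "tilted ?F" by (rule prob_space_tilted) simp
  have le: "card (G S N) \<le> card (V S N)" by (intro card_mono well_visited_subset) simp
  have "card (V S N) \<le> 9 * card (G S N)" by (rule card_visited_le[OF S blocks_le])
  moreover have "18 * (card (V S N) div 18) \<le> card (V S N)" by simp
  ultimately have n: "card (V S N) \<le> 18 * ?n" by linarith
  have ind: "P.indep_vars (\<lambda>_. borel) Q UNIV"
    by (intro P.indep_tile_form indep_tilted) simp
  have "P.prob (typical S N) \<le> 2 ^ card (G S N) * rare ^ ?n"
    using P.prob_many_indep_le[OF ind, of "{..<r}" "G S N" rare ?n]
      prob_low[OF S blocks_le] rare_nonneg finite_G
    by (simp add: typical_def tilted_space)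
  also have "\<dots> \<le> 2 ^ card (V S N) * (1 / 324) ^ card (V S N)"
    using le rare_power[OF n] rare_nonneg by (intro mult_mono power_increasing) auto
  also have "\<dots> = (1 / 162) ^ card (V S N)" by (simp add: power_mult_distrib[symmetric])
  also have "\<dots> \<le> (1 / 2) ^ card (V S N)" by (intro power_mono) auto
  finally show ?thesis .
qed

text \<open>The visited tiles are the range of a covering walk, so outside \<open>bad\<close> few of
  them, and a fortiori few well visited ones, have large \<open>Q\<close>.\<close>

lemma typical_of_not_bad:
  assumes S: "S \<in> saws N" and b: "blocks N > 0" and t: "t \<in> space M" "t \<notin> bad (card (V S N))"
  shows "t \<in> typical S N"
proof -
  let ?k = "card (V S N)"
  obtain xs where xs: "xs \<in> walks 0 (2 * (?k - 1))" "set xs = V S N"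
    using visited_covering_walk[OF S blocks_le b] by blast
  have "\<not> Suc (?k div 18) \<le> card {a \<in> V S N. Q a t \<in> {r..}}"
  proof
    assume "Suc (?k div 18) \<le> card {a \<in> V S N. Q a t \<in> {r..}}"
    then have "t \<in> bad ?k" unfolding bad_def using xs t(1) by (intro CollectI conjI bexI[of _ xs]) auto
    with t(2) show False by simp
  qed
  then have "card {a \<in> V S N. Q a t \<in> {r..}} \<le> ?k div 18" by simp
  moreover have "card {a \<in> G S N. Q a t \<in> {r..}} \<le> card {a \<in> V S N. Q a t \<in> {r..}}"
    using well_visited_subset by (intro card_mono) auto
  moreover have "card (G S N) = card {a \<in> G S N. Q a t \<in> {r..}} + card {a \<in> G S N. Q a t \<in> {..<r}}"
    using finite_G by (subst card_Un_disjoint[symmetric]) (auto intro!: arg_cong[where f = card])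
  ultimately show ?thesis using t(1) by (simp add: typical_def)
qed

section \<open>The truncated partition function\<close>

definition truncated :: "nat \<Rightarrow> 'a \<Rightarrow> real" where
  "truncated N t = (\<Sum>S\<in>saws N. path_weight S N t * indicator (typical S N) t)"

text \<open>A path visits at least \<open>(N + 1) / 4 ^ scale - 1\<close> tiles, so the gain is
  \<open>decay ^ (2 * (N + 1))\<close> up to a constant. The extra 2 splits it into two halves, one
  for \<open>level\<close> and one for Markov's inequality.\<close>

definition decay :: real where "decay = (1 / 2) powr (1 / (2 * 4 ^ scale))"

lemma decay: "0 < decay" "decay < 1"
proof -
  show "0 < decay" by (simp add: decay_def)
  have "(1 / 2 :: real) powr (1 / (2 * 4 ^ scale)) < (1 / 2) powr 0"
    by (rule powr_less_mono') auto
  then show "decay < 1" by (simp add: decay_def)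
qed

text \<open>The added 1 pays for the sites after the last complete segment, fewer than
  \<open>2 ^ scale\<close> of them.\<close>

lemma card_V_ge:
  assumes S: "S \<in> saws N"
  shows "N + 1 \<le> (card (V S N) + 1) * 4 ^ scale"
proof -
  have e: "(4::nat) ^ scale = 2 ^ scale * 2 ^ scale" by (simp add: power_mult_distrib[symmetric])
  have "N + 1 = blocks N * 2 ^ scale + (N + 1) mod 2 ^ scale"
    unfolding blocks_def by (simp only: div_mult_mod_eq)
  moreover have "(N + 1) mod 2 ^ scale \<le> 2 ^ scale" by (simp add: less_imp_le)
  moreover have "(2::nat) ^ scale \<le> 4 ^ scale" by (intro power_mono) auto
  moreover have "blocks N * 2 ^ scale \<le> (card (V S N) * 2 ^ scale) * 2 ^ scale"
    by (intro mult_right_mono card_visited_ge[OF S blocks_le]) simp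
  then have "blocks N * 2 ^ scale \<le> card (V S N) * 4 ^ scale" by (simp only: e mult.assoc)
  moreover have "(card (V S N) + 1) * 4 ^ scale = card (V S N) * 4 ^ scale + 4 ^ scale" by simp
  ultimately show ?thesis by linarith
qed

lemma half_power_card_V:
  assumes S: "S \<in> saws N"
  shows "(1 / 2) ^ card (V S N) \<le> 2 * decay ^ (2 * (N + 1))"
proof -
  have "real (N + 1) \<le> real ((card (V S N) + 1) * 4 ^ scale)"
    using card_V_ge[OF S] by (simp only: of_nat_le_iff)
  then have "real (N + 1) / 4 ^ scale \<le> real (card (V S N)) + 1"
    by (simp add: field_simps)
  then have "(1 / 2 :: real) powr (real (card (V S N)) + 1) \<le> (1 / 2) powr (real (N + 1) / 4 ^ scale)"
    by (intro powr_mono') auto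
  also have "\<dots> = decay powr real (2 * (N + 1))"
  proof -
    have "1 / (2 * 4 ^ scale) * real (2 * (N + 1)) = real (N + 1) / 4 ^ scale"
      by (simp add: field_simps)
    then show ?thesis unfolding decay_def powr_powr by simp
  qed
  also have "\<dots> = decay ^ (2 * (N + 1))" using decay by (intro powr_realpow)
  finally show ?thesis by (simp add: powr_add powr_realpow)
qed

lemma truncated_integrable: "integrable M (truncated N)"
  unfolding truncated_def
  by (intro Bochner_Integration.integrable_sum path_weight_tilted(1) typical_sets)

lemma expectation_truncated:
  "expectation (truncated N) \<le> real (card (saws N)) * mgf ^ Suc N * (2 * decay ^ (2 * (N + 1)))"
proof -
  have "expectation (truncated N)
      = (\<Sum>S\<in>saws N. mgf ^ Suc N * measure (tilted (S ` {0..N})) (typical S N))"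
    unfolding truncated_def
    by (subst Bochner_Integration.integral_sum)
       (auto intro!: path_weight_tilted(1) sum.cong path_weight_tilted(2) simp del: power_Suc)
  also have "\<dots> \<le> (\<Sum>S\<in>saws N. mgf ^ Suc N * (2 * decay ^ (2 * (N + 1))))"
    using mgf_ge_1
    by (intro sum_mono mult_left_mono order_trans[OF typical_tilted half_power_card_V]) auto
  finally show ?thesis by simp
qed

text \<open>The annealed value times half of the exponential gain; the other half makes the Markov
  bound summable.\<close>

definition level :: "nat \<Rightarrow> real" where
  "level N = real (card (saws N)) * (mgf * decay) ^ Suc N"

lemma level_pos: "level N > 0"
  using card_saws_pos[of N] mgf_ge_1 decay by (simp add: level_def)

lemma prob_truncated_ge: "prob {t \<in> space M. level N \<le> truncated N t} \<le> 2 * decay ^ Suc N"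
proof -
  have "prob {t \<in> space M. level N \<le> truncated N t} \<le> expectation (truncated N) / level N"
  proof (rule integral_Markov_inequality_measure[OF truncated_integrable, of "{}"])
    show "AE t in M. 0 \<le> truncated N t"
      unfolding truncated_def by (intro AE_I2 sum_nonneg) auto
  qed (simp_all add: level_pos)
  also have "\<dots> \<le> (real (card (saws N)) * mgf ^ Suc N * (2 * decay ^ (2 * (N + 1)))) / level N"
    using level_pos by (intro divide_right_mono expectation_truncated) (simp add: less_imp_le)
  also have "\<dots> = 2 * decay ^ Suc N"
  proof -
    have "decay ^ (2 * (N + 1)) = decay ^ Suc N * decay ^ Suc N"
      by (simp add: power_add[symmetric] mult_2)
    then show ?thesis
      using card_saws_pos[of N] mgf_ge_1 decay
      by (simp add: level_def power_mult_distrib field_simps del: power_Suc)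
  qed
  finally show ?thesis .
qed

text \<open>Borel-Cantelli is applied once to \<open>bad k\<close> in the number \<open>k\<close> of
  tiles and once to the truncated sums in \<open>N\<close>. As \<open>card (V S N)\<close> grows
  with \<open>N\<close> uniformly over the paths, all paths are eventually typical and truncation
  changes nothing.\<close>

lemma AE_partition_fun_less:
  "AE t in M. eventually (\<lambda>N. partition_fun \<beta> (\<lambda>x. \<omega> x t) N < level N) sequentially"
proof -
  have [measurable]: "truncated N \<in> borel_measurable M" for N
    using truncated_integrable by auto
  have 1: "AE t in M. eventually (\<lambda>k. t \<in> space M - bad k) sequentially"
  proof (rule borel_cantelli_AE1)
    show "summable (\<lambda>k. prob (bad k))"
      by (rule summable_comparison_test'[of "\<lambda>k. (1 / 2) ^ k" 0]) (auto simp: prob_bad)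
  qed (auto simp: emeasure_eq_measure)
  have 2: "AE t in M. eventually
      (\<lambda>N. t \<in> space M - {t \<in> space M. level N \<le> truncated N t}) sequentially"
  proof (rule borel_cantelli_AE1)
    have "summable (\<lambda>N. 2 * decay ^ Suc N)"
      using decay by (intro summable_mult summable_ignore_initial_segment[of _ 1, simplified])
        (simp add: summable_mult)
    then show "summable (\<lambda>N. prob {t \<in> space M. level N \<le> truncated N t})"
      by (rule summable_comparison_test'[of _ 0]) (auto simp: prob_truncated_ge simp del: power_Suc)
  qed (auto simp: emeasure_eq_measure)
  show ?thesis using 1 2
  proof eventually_elim
    case (elim t)
    obtain k0 where k0: "\<And>k. k \<ge> k0 \<Longrightarrow> t \<in> space M - bad k"
      using elim(1) by (auto simp: eventually_sequentially)
    have "eventually (\<lambda>N. partition_fun \<beta> (\<lambda>x. \<omega> x t) N = truncated N t) sequentially"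
    \<comment> \<open>By \<open>card_V_ge\<close>, from this \<open>N\<close> on every path visits
      at least \<open>k0\<close> tiles.\<close>
    proof (rule eventually_sequentiallyI[of "(k0 + 1) * 4 ^ scale"])
      fix N assume N: "N \<ge> (k0 + 1) * 4 ^ scale"
      have "(2::nat) ^ scale \<le> 4 ^ scale" by (intro power_mono) auto
      also have "\<dots> \<le> (k0 + 1) * 4 ^ scale" by simp
      also have "\<dots> \<le> N + 1" using N by simp
      finally have b: "blocks N > 0" by (simp add: blocks_def div_greater_zero_iff)
      have "t \<in> typical S N" if S: "S \<in> saws N" for S
      proof -
        have "(k0 + 1) * 4 ^ scale < (card (V S N) + 1) * 4 ^ scale"
          using N card_V_ge[OF S] by linarith
        then have "k0 \<le> card (V S N)" by simp
        then show ?thesis using k0 by (intro typical_of_not_bad[OF S b]) auto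
      qed
      then show "partition_fun \<beta> (\<lambda>x. \<omega> x t) N = truncated N t"
        unfolding partition_fun_def truncated_def by (intro sum.cong) auto
    qed
    with elim(2) show ?case by eventually_elim auto
  qed
qed

section \<open>Passage to the N-th root\<close>

lemma root_power_tendsto:
  assumes "x > 0"
  shows "(\<lambda>N. (real (card (saws N)) * x ^ Suc N) powr (1 / real N)) \<longlonglongrightarrow> connective_constant * x"
proof -
  \<comment> \<open>There are \<open>N + 1\<close> factors \<open>x\<close> under an
    \<open>N\<close>-th root, so one surplus factor remains, whose root tends to 1.\<close>
  have "(\<lambda>N. x powr (1 / real N)) \<longlonglongrightarrow> x powr 0"
    using assms by (intro tendsto_powr tendsto_const lim_1_over_n) auto
  then have "(\<lambda>N. real (card (saws N)) powr (1 / real N) * (x * x powr (1 / real N)))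
      \<longlonglongrightarrow> connective_constant * (x * x powr 0)"
    by (intro tendsto_mult connective_constant_tendsto tendsto_const)
  then have "(\<lambda>N. real (card (saws N)) powr (1 / real N) * (x * x powr (1 / real N)))
      \<longlonglongrightarrow> connective_constant * x" using assms by simp
  then show ?thesis
  proof (rule Lim_transform_eventually)
    show "eventually (\<lambda>N. real (card (saws N)) powr (1 / real N) * (x * x powr (1 / real N))
        = (real (card (saws N)) * x ^ Suc N) powr (1 / real N)) sequentially"
    proof (rule eventually_sequentiallyI[of 1])
      fix N :: nat assume N: "1 \<le> N"
      have "(x ^ N) powr (1 / real N) = x"
        using assms N by (simp add: powr_realpow[symmetric] powr_powr)
      then show "real (card (saws N)) powr (1 / real N) * (x * x powr (1 / real N))
          = (real (card (saws N)) * x ^ Suc N) powr (1 / real N)"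
        using assms by (simp add: powr_mult mult_ac)
    qed
  qed
qed

lemma limsup_annealed:
  "limsup (\<lambda>N. ereal (expectation (\<lambda>t. partition_fun \<beta> (\<lambda>x. \<omega> x t) N) powr (1 / real N)))
    = ereal (connective_constant * mgf)"
proof (rule lim_imp_Limsup)
  show "(\<lambda>N. ereal (expectation (\<lambda>t. partition_fun \<beta> (\<lambda>x. \<omega> x t) N) powr (1 / real N)))
      \<longlonglongrightarrow> ereal (connective_constant * mgf)"
    unfolding expectation_partition_fun
    using mgf_ge_1 by (intro tendsto_ereal root_power_tendsto) simp
qed simp

lemma limsup_quenched:
  "AE t in M. limsup (\<lambda>N. ereal (partition_fun \<beta> (\<lambda>x. \<omega> x t) N powr (1 / real N)))
    < ereal (connective_constant * mgf)"
  using AE_partition_fun_less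
proof eventually_elim
  case (elim t)
  have nn: "0 \<le> partition_fun \<beta> (\<lambda>x. \<omega> x t) N" for N
    unfolding partition_fun_def by (intro sum_nonneg) simp
  have "limsup (\<lambda>N. ereal (partition_fun \<beta> (\<lambda>x. \<omega> x t) N powr (1 / real N)))
      \<le> limsup (\<lambda>N. ereal (level N powr (1 / real N)))"
    by (rule Limsup_mono, use elim in eventually_elim) (auto intro!: powr_mono2 nn)
  also have "\<dots> = ereal (connective_constant * (mgf * decay))"
    unfolding level_def using mgf_ge_1 decay
    by (intro lim_imp_Limsup tendsto_ereal root_power_tendsto) auto
  \<comment> \<open>Strictness comes from \<open>decay < 1\<close>, the other two factors being
    positive.\<close>
  also have "\<dots> < ereal (connective_constant * mgf)"
    using mgf_ge_1 decay connective_constant_ge_1 by simp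
  finally show ?case .
qed

end

theorem theorem5p1:
  fixes M :: "'a measure" and \<omega> :: "int \<times> int \<Rightarrow> 'a \<Rightarrow> real" and \<beta> :: real
  assumes "prob_space M"
    and indep: "prob_space.indep_vars M (\<lambda>_. borel) \<omega> UNIV"
    and ident: "\<And>x. distr M borel (\<omega> x) = distr M borel (\<omega> 0)"
    and mean: "prob_space.expectation M (\<omega> 0) = 0"
    and var: "prob_space.variance M (\<omega> 0) = 1"
    and exp_moments: "\<And>b::real. integrable M (\<lambda>t. exp (b * \<omega> 0 t))"
    and "\<beta> \<noteq> 0"
  shows "(AE t in M.
            limsup (\<lambda>N. ereal (partition_fun \<beta> (\<lambda>x. \<omega> x t) N powr (1 / real N)))
              < limsup (\<lambda>N. ereal
                  (prob_space.expectation M (\<lambda>s. partition_fun \<beta> (\<lambda>x. \<omega> x s) N)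
                     powr (1 / real N))))
       \<and> limsup (\<lambda>N. ereal
             (prob_space.expectation M (\<lambda>s. partition_fun \<beta> (\<lambda>x. \<omega> x s) N)
                powr (1 / real N)))
           = ereal (connective_constant * exp (log_mgf M (\<omega> 0) \<beta>))"
proof -
  interpret random_environment M \<omega> \<beta>
    using assms by (simp add: random_environment_def random_environment_axioms_def)
  have "exp (log_mgf M (\<omega> 0) \<beta>) = mgf"
    using mgf_ge_1 by (simp add: log_mgf_def mgf_def)
  then show ?thesis using limsup_annealed limsup_quenched by simp
qed

end
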